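(* Let $\mathcal F=\{f_1,\dots,f_k\}$ be a defining family of convenient non-degenerate complete intersection varieties in a neighborhood of the origin of $\mathbb C^n$ (with $f_\alpha(\mathbf 0)=0$ for all $\alpha$), let $m_1,\dots,m_k$ be positive integers, and let $g=f_1^{m_1}\cdots f_k^{m_k}$. For $1\le\alpha\le k$, $1\le j\le n$ let $z_j^{b_{\alpha,j}}$ be the monomial corresponding to the unique point of $\Gamma(f_\alpha)$ on the $z_j$-axis, and put $\widetilde B_j=\sum_{\alpha=1}^k m_\alpha b_{\alpha,j}$ and $\widetilde B=\max\{\widetilde B_1,\dots,\widetilde B_n\}$. Then $$\theta_0(g)\le 1-\frac1{\widetilde B}.$$ Furthermore, if $g$ has a non-exceptional Łojasiewicz monomial, the equality holds.
   Context: Łojasiewicz exponent: for an analytic $g$, $\partial g=(\partial g/\partial z_1,\dots,\partial g/\partial z_n)$, and $\theta_0(g)$ is the infimum of all $\theta\in[0,1)$ for which there exist $c>0$ and a neighborhood $U$ of $\mathbf 0$ with $\|\partial g(\mathbf z)\|\ge c|g(\mathbf z)|^\theta$ for all $\mathbf z\in U$. For an analytic function $h(\mathbf z)=\sum_\nu c_\nu\mathbf z^\nu$, $\Gamma_+(h)$ is the convex hull of $\bigcup_{c_\nu\ne0}(\nu+\mathbb R_+^n)$, and the Newton boundary $\Gamma(h)$ is the union of compact faces of $\Gamma_+(h)$. For a strictly positive weight vector $P=(p_1,\dots,p_n)$ (all $p_i>0$), $\Delta(P,h)$ is the face of $\Gamma_+(h)$ where $\nu\mapsto\sum_i p_i\nu_i$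 is minimal and $h_P(\mathbf z)=\sum_{\nu\in\Delta(P,h)}c_\nu\mathbf z^\nu$. $h$ is non-degenerate if $h_P:\mathbb C^{*n}\to\mathbb C$ has no critical point for every strictly positive $P$, where $\mathbb C^{*n}=\{\mathbf z\mid z_i\ne0\ \forall i\}$. $h$ is convenient if $\Gamma(h)$ meets each coordinate axis. $\mathcal F=\{f_1,\dots,f_k\}$ is a defining family of convenient non-degenerate complete intersection varieties if each $f_\alpha$ is a convenient non-degenerate function and, for each $I\subset\{1,\dots,k\}$, $V(I)=\{f_i=0,\ i\in I\}$ is a non-degenerate complete intersection variety, i.e. for every strictly positive weight vector $P$ the variety $V_I(P)^*=\{\mathbf z\in\mathbb C^{*n}\mid f_{jP}(\mathbf z)=0,\ j\in I\}$ is a smooth complete intersection in $\mathbb C^{*n}$ (the gradients $\partial f_{jP}$, $j\in I$, are linearly independent at every point of $V_I(P)^*$; the variety may be empty). Here $f_{jP}$ denotes the face function $(f_j)_P$. The point of $\Gamma(g)$ on the $z_j$-axis corresponds to $z_j^{\widetilde B_j}$. This monomial is called a Łojasiewicz monomial of $g$ if $\widetilde B_j=\widetilde B$. It is exceptional if moreover there exist $i\neq j$ and a monomial $z_j^{B'}z_i$ appearing in $g(\mathbf z)$ (with non-zero coefficient) with $B'<\widetilde B-1$. Otherwise a Łojasiewicz monomial is called non-exceptional. *)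

theory Defs
  imports "HOL-Analysis.Analysis"
begin

definition monomial_at :: "nat ^ 'n \<Rightarrow> complex ^ 'n \<Rightarrow> complex"
  where "monomial_at \<nu> z = (\<Prod>i\<in>UNIV. (z $ i) ^ (\<nu> $ i))"

definition has_power_series :: "(complex ^ 'n \<Rightarrow> complex) \<Rightarrow> (nat ^ 'n \<Rightarrow> complex) \<Rightarrow> bool"
  where "has_power_series h c \<longleftrightarrow>
    (\<forall>\<^sub>F z in nhds 0. ((\<lambda>\<nu>. c \<nu> * monomial_at \<nu> z) has_sum h z) UNIV)"

definition analytic_at_origin :: "(complex ^ 'n \<Rightarrow> complex) \<Rightarrow> bool"
  where "analytic_at_origin h \<longleftrightarrow> (\<exists>c. has_power_series h c)"

text \<open>The power series expansion of an analytic germ is unique, so the description below is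
  proper whenever \<open>h\<close> is analytic at the origin.\<close>

definition coefficient :: "(complex ^ 'n \<Rightarrow> complex) \<Rightarrow> nat ^ 'n \<Rightarrow> complex"
  where "coefficient h = (THE c. has_power_series h c)"

definition gradient :: "(complex ^ 'n \<Rightarrow> complex) \<Rightarrow> complex ^ 'n \<Rightarrow> complex ^ 'n"
  where "gradient h z = (\<chi> i. deriv (\<lambda>w. h (\<chi> l. if l = i then w else z $ l)) (z $ i))"

text \<open>The infimum is taken in the extended reals, so that it is \<open>\<infinity>\<close> when no exponent
  \<open>\<theta> < 1\<close> is admissible.\<close>

definition lojasiewicz_exponent :: "(complex ^ 'n \<Rightarrow> complex) \<Rightarrow> ereal"
  where "lojasiewicz_exponent g =
    Inf (ereal ` {\<theta>. 0 \<le> \<theta> \<and> \<theta> < 1 \<and>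
      (\<exists>c>0. \<forall>\<^sub>F z in nhds 0. norm (gradient g z) \<ge> c * norm (g z) powr \<theta>)})"

definition exponent_vector :: "nat ^ 'n \<Rightarrow> real ^ 'n"
  where "exponent_vector \<nu> = (\<chi> i. real (\<nu> $ i))"

definition newton_polyhedron :: "(complex ^ 'n \<Rightarrow> complex) \<Rightarrow> (real ^ 'n) set"
  where "newton_polyhedron h = convex hull
    (\<Union>\<nu>\<in>{\<nu>. coefficient h \<nu> \<noteq> 0}. {exponent_vector \<nu> + x | x. \<forall>i. 0 \<le> x $ i})"

definition newton_boundary :: "(complex ^ 'n \<Rightarrow> complex) \<Rightarrow> (real ^ 'n) set"
  where "newton_boundary h = \<Union>{F. F face_of newton_polyhedron h \<and> compact F}"

definition strictly_positive :: "real ^ 'n \<Rightarrow> bool"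
  where "strictly_positive P \<longleftrightarrow> (\<forall>i. 0 < P $ i)"

definition weight_face :: "real ^ 'n \<Rightarrow> (complex ^ 'n \<Rightarrow> complex) \<Rightarrow> (real ^ 'n) set"
  where "weight_face P h =
    {x \<in> newton_polyhedron h. \<forall>y \<in> newton_polyhedron h. P \<bullet> x \<le> P \<bullet> y}"

text \<open>For strictly positive \<open>P\<close> the face is compact, so the index set of the sum is finite.\<close>

definition face_function ::
    "real ^ 'n \<Rightarrow> (complex ^ 'n \<Rightarrow> complex) \<Rightarrow> complex ^ 'n \<Rightarrow> complex"
  where "face_function P h z =
    (\<Sum>\<nu> | exponent_vector \<nu> \<in> weight_face P h. coefficient h \<nu> * monomial_at \<nu> z)"

definition torus :: "(complex ^ 'n) set"
  where "torus = {z. \<forall>i. z $ i \<noteq> 0}"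

definition nondegenerate :: "(complex ^ 'n \<Rightarrow> complex) \<Rightarrow> bool"
  where "nondegenerate h \<longleftrightarrow>
    (\<forall>P. strictly_positive P \<longrightarrow> (\<forall>z\<in>torus. gradient (face_function P h) z \<noteq> 0))"

definition convenient :: "(complex ^ 'n \<Rightarrow> complex) \<Rightarrow> bool"
  where "convenient h \<longleftrightarrow> (\<forall>j. \<exists>t. axis j t \<in> newton_boundary h)"

text \<open>Linear independence over the complex numbers is required of the indexed family of
  gradients, so equal gradients at two different indices count as dependent.\<close>

definition nondegenerate_complete_intersection ::
    "'a set \<Rightarrow> ('a \<Rightarrow> complex ^ 'n \<Rightarrow> complex) \<Rightarrow> bool"
  where "nondegenerate_complete_intersection I f \<longleftrightarrow>
    (\<forall>P. strictly_positive P \<longrightarrow>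
      (\<forall>z\<in>torus. (\<forall>j\<in>I. face_function P (f j) z = 0) \<longrightarrow>
        (\<forall>a. (\<Sum>j\<in>I. a j *s gradient (face_function P (f j)) z) = 0 \<longrightarrow> (\<forall>j\<in>I. a j = 0))))"

definition convenient_nondegenerate_family ::
    "nat \<Rightarrow> (nat \<Rightarrow> complex ^ 'n \<Rightarrow> complex) \<Rightarrow> bool"
  where "convenient_nondegenerate_family k f \<longleftrightarrow>
    (\<forall>\<alpha>\<in>{1..k}. analytic_at_origin (f \<alpha>) \<and> convenient (f \<alpha>) \<and> nondegenerate (f \<alpha>)) \<and>
    (\<forall>I \<subseteq> {1..k}. nondegenerate_complete_intersection I f)"

text \<open>A compact face of the Newton polyhedron is the minimal face of a strictly positive weight,
  so the Newton boundary has at most one point on each axis; this point is a vertex, hence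
  integral.\<close>

definition axis_exponent :: "(complex ^ 'n \<Rightarrow> complex) \<Rightarrow> 'n \<Rightarrow> nat"
  where "axis_exponent h j = (THE b. axis j (real b) \<in> newton_boundary h)"

definition lojasiewicz_monomial :: "(complex ^ 'n \<Rightarrow> complex) \<Rightarrow> 'n \<Rightarrow> bool"
  where "lojasiewicz_monomial g j \<longleftrightarrow> axis_exponent g j = Max (range (axis_exponent g))"

text \<open>The multi-index below is that of \<open>z\<^sub>j ^ B' * z\<^sub>i\<close>; the case \<open>B' = 0\<close> is included.\<close>

definition exceptional :: "(complex ^ 'n \<Rightarrow> complex) \<Rightarrow> 'n \<Rightarrow> bool"
  where "exceptional g j \<longleftrightarrow> lojasiewicz_monomial g j \<and>
    (\<exists>i B'. i \<noteq> j \<and> coefficient g (\<chi> l. if l = j then B' else if l = i then 1 else 0) \<noteq> 0 \<and>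
      B' + 1 < Max (range (axis_exponent g)))"

end

theory Submission
  imports Defs "HOL-Complex_Analysis.Cauchy_Integral_Formula"
begin

text \<open>
  Write \<open>L g = (z\<^sub>i \<partial>\<^sub>i g)\<^sub>i\<close> for the logarithmic gradient, and for each factor let \<open>M\<^sub>\<alpha> z\<close> be the
  sum of the absolute values of the finitely many monomials \<open>z ^ \<nu>\<close> of \<open>f\<^sub>\<alpha>\<close> with
  \<open>\<nu>\<^sub>i \<le> b\<^sub>\<alpha>\<^sub>i\<close> for all \<open>i\<close>, where \<open>b\<^sub>\<alpha>\<^sub>i\<close> is the exponent of \<open>f\<^sub>\<alpha>\<close> on
  the axis \<open>i\<close>. The upper bound rests on one inequality, valid for every \<open>\<beta>\<close> at the points of the torus near
  the origin (\<open>log_gradient_lower_bound\<close>):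
  \<open>c * |g| * M\<^sub>\<beta> \<le> |L g| * |f\<^sub>\<beta>|\<close>.

  This inequality implies the estimate on the gradient by comparing exponents. Let \<open>\<epsilon>\<close> be the least of
  the ratios \<open>|f\<^sub>\<alpha>| / M\<^sub>\<alpha>\<close>. Then \<open>c * |g| \<le> \<epsilon> * |L g|\<close>, while \<open>|z\<^sub>i| ^ b\<^sub>\<alpha>\<^sub>i \<le> M\<^sub>\<alpha>\<close> gives
  \<open>|g| \<ge> \<epsilon> ^ S * |z\<^sub>i| ^ B\<^sub>i\<close> with \<open>S\<close> the sum of the \<open>m\<^sub>\<alpha>\<close>. Both \<open>S\<close> and \<open>B\<^sub>i\<close> are at most the
  maximal exponent \<open>B\<close>, so \<open>\<epsilon> * |z\<^sub>i| \<le> C * |g| ^ (1 / B)\<close>; summing over \<open>i\<close> yields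
  \<open>|g| \<le> C' * |g| ^ (1 / B) * |\<partial> g|\<close>. The points off the torus follow by continuity.

  The key inequality is proved by contradiction, and compactness takes the place of the curve selection
  lemma. A sequence in the torus that violates it converges to the origin and has a subsequence along
  which, after multiplication by positive factors \<open>E\<^sub>\<alpha>\<close>, every monomial of every \<open>M\<^sub>\<alpha>\<close> converges: to
  \<open>u ^ \<nu>\<close> if \<open>\<nu>\<close> lies on the face that a suitable strictly positive weight \<open>Q\<close> selects, and to \<open>0\<close>
  otherwise, with a point \<open>u\<close> of the torus (\<open>toric_limit\<close>). Hence \<open>E\<^sub>\<alpha> f\<^sub>\<alpha>\<close> and \<open>E\<^sub>\<alpha> L f\<^sub>\<alpha>\<close> converge to the
  values at \<open>u\<close> of the face function and of its logarithmic gradient (\<open>initial_form_limit_face\<close>). Because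
  \<open>L g / g\<close> is the sum of the \<open>m\<^sub>\<alpha> L f\<^sub>\<alpha> / f\<^sub>\<alpha>\<close>, normalising the coefficients \<open>m\<^sub>\<alpha> / (E\<^sub>\<alpha> f\<^sub>\<alpha>)\<close> produces in
  the limit a nontrivial linear relation between the gradients of the face functions at \<open>u\<close>. Euler's
  identity for weighted homogeneous polynomials shows that it only involves those \<open>\<alpha>\<close> whose face function
  vanishes at \<open>u\<close>, and this contradicts the non-degeneracy of the complete intersection
  (\<open>no_degenerate_limit\<close>).

  For the equality, restrict to the axis of a non-exceptional monomial: there \<open>g\<close> has order exactly \<open>B\<close>,
  and every partial derivative has order at least \<open>B - 1\<close>, which forces \<open>\<theta> \<ge> 1 - 1 / B\<close>
  (\<open>exponent_lower_bound\<close>).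
\<close>

section \<open>Power series in several variables\<close>

definition total_degree :: "nat ^ 'n \<Rightarrow> nat"
  where "total_degree \<nu> = (\<Sum>i\<in>UNIV. \<nu> $ i)"

definition polydisc :: "real \<Rightarrow> (complex ^ 'n) set"
  where "polydisc r = {z. \<forall>i. norm (z $ i) \<le> r}"

abbreviation replace :: "'n \<Rightarrow> complex ^ 'n \<Rightarrow> complex \<Rightarrow> complex ^ 'n"
  where "replace i z w \<equiv> (\<chi> l. if l = i then w else z $ l)"

text \<open>
  Convergence of a power series of several variables near the origin is handled through one closed polydisc:
  absolute summability at the point all of whose coordinates are \<open>r\<close> bounds every term on the polydisc.
\<close>

definition converges_on :: "real \<Rightarrow> (complex ^ 'n \<Rightarrow> complex) \<Rightarrow> (nat ^ 'n \<Rightarrow> complex) \<Rightarrow> bool"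
  where "converges_on r h c \<longleftrightarrow> 0 < r \<and> (\<lambda>\<nu>. norm (c \<nu>) * r ^ total_degree \<nu>) summable_on UNIV \<and>
    (\<forall>z\<in>polydisc r. ((\<lambda>\<nu>. c \<nu> * monomial_at \<nu> z) has_sum h z) UNIV)"

lemma norm_monomial_at: "norm (monomial_at \<nu> z) = (\<Prod>i\<in>UNIV. norm (z $ i) ^ (\<nu> $ i))"
  by (simp add: monomial_at_def norm_power flip: prod_norm)

lemma monomial_at_add: "monomial_at (\<nu> + \<mu>) z = monomial_at \<nu> z * monomial_at \<mu> z"
  by (simp add: monomial_at_def power_add prod.distrib)

lemma monomial_at_axis: "monomial_at (axis j a) z = z $ j ^ a"
proof -
  have "monomial_at (axis j a) z = (\<Prod>i\<in>UNIV. if i = j then z $ i ^ a else 1)"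
    unfolding monomial_at_def by (intro prod.cong) (auto simp: axis_def)
  then show ?thesis by simp
qed

lemma total_degree_add: "total_degree (\<nu> + \<mu>) = total_degree \<nu> + total_degree \<mu>"
  by (simp add: total_degree_def sum.distrib)

lemma total_degree_axis: "total_degree (axis j a) = a"
  by (simp add: total_degree_def axis_def)

lemma norm_monomial_at_le:
  assumes "z \<in> polydisc r" shows "norm (monomial_at \<nu> z) \<le> r ^ total_degree \<nu>"
  unfolding norm_monomial_at total_degree_def power_sum
  by (intro prod_mono) (use assms in \<open>auto simp: polydisc_def power_mono\<close>)

lemma norm_monomial_at_const:
  assumes "0 \<le> r" shows "norm (monomial_at \<nu> (\<chi> i. of_real r)) = r ^ total_degree \<nu>"
  using assms by (simp add: norm_monomial_at total_degree_def power_sum)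

lemma eventually_in_polydisc:
  assumes "0 < r" shows "\<forall>\<^sub>F z in nhds (0 :: complex ^ 'n). \<forall>i. norm (z $ i) < r"
proof -
  have "\<forall>\<^sub>F z in nhds (0::complex^'n). norm z < r"
    using assms by (auto simp: eventually_nhds_metric dist_norm intro!: exI[of _ r])
  then show ?thesis
    by (rule eventually_mono) (auto intro: le_less_trans[OF Finite_Cartesian_Product.norm_nth_le])
qed

text \<open>
  Over the complex numbers unconditional and absolute summability coincide, so that convergence at the single
  corner point \<open>(r, \<dots>, r)\<close> supplies the dominating series.
\<close>

lemma converges_onI:
  assumes r: "0 < r" and hs: "\<And>z. z \<in> polydisc r \<Longrightarrow> ((\<lambda>\<nu>. c \<nu> * monomial_at \<nu> z) has_sum h z) UNIV"
  shows "converges_on r h c"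
proof -
  have "(\<chi> i. of_real r) \<in> polydisc r" using r by (simp add: polydisc_def)
  then have "(\<lambda>\<nu>. c \<nu> * monomial_at \<nu> (\<chi> i. of_real r)) summable_on UNIV"
    using hs has_sum_imp_summable by blast
  then have "(\<lambda>\<nu>. norm (c \<nu> * monomial_at \<nu> (\<chi> i. of_real r))) summable_on UNIV"
    by (rule summable_on_iff_abs_summable_on_complex[THEN iffD1])
  then show ?thesis
    using r hs by (simp add: converges_on_def norm_mult norm_monomial_at_const)
qed

lemma has_power_series_iff: "has_power_series h c \<longleftrightarrow> (\<exists>r. converges_on r h c)"
proof
  assume "has_power_series h c"
  then obtain e where e: "0 < e"
    "\<And>z. norm z < e \<Longrightarrow> ((\<lambda>\<nu>. c \<nu> * monomial_at \<nu> z) has_sum h z) UNIV"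
    unfolding has_power_series_def eventually_nhds_metric by (auto simp: dist_norm)
  define r where "r = e / (2 * real CARD('a))"
  have r: "0 < r" using e by (simp add: r_def)
  have "norm z < e" if "z \<in> polydisc r" for z :: "complex^'a"
  proof -
    have "norm z \<le> (\<Sum>i\<in>UNIV. norm (z $ i))" by (simp add: norm_vec_def L2_set_le_sum)
    also have "\<dots> \<le> (\<Sum>i\<in>(UNIV::'a set). r)"
      using that by (intro sum_mono) (auto simp: polydisc_def)
    also have "\<dots> < e" using e by (simp add: r_def)
    finally show ?thesis .
  qed
  then show "\<exists>r. converges_on r h c" using converges_onI r e by blast
next
  assume "\<exists>r. converges_on r h c"
  then obtain r where r: "converges_on r h c" ..
  then have "0 < r" by (simp add: converges_on_def)
  then show "has_power_series h c" unfolding has_power_series_def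
    by (rule eventually_mono[OF eventually_in_polydisc])
      (use r in \<open>auto simp: converges_on_def polydisc_def less_imp_le\<close>)
qed

lemma converges_on_uniform_limit:
  assumes "converges_on r h c"
  shows "uniform_limit (polydisc r) (\<lambda>X z. \<Sum>\<nu>\<in>X. c \<nu> * monomial_at \<nu> z) h (finite_subsets_at_top UNIV)"
proof (rule Weierstrass_m_test_general')
  show "norm (c \<nu> * monomial_at \<nu> z) \<le> norm (c \<nu>) * r ^ total_degree \<nu>" if "z \<in> polydisc r" for \<nu> z
    using norm_monomial_at_le[OF that] by (simp add: norm_mult mult_left_mono)
qed (use assms in \<open>auto simp: converges_on_def\<close>)

lemma continuous_on_monomial_at [continuous_intros]: "continuous_on S (monomial_at \<nu>)"
  unfolding monomial_at_def by (intro continuous_intros)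

lemma converges_on_continuous:
  assumes "converges_on r h c" shows "continuous_on (polydisc r) h"
  by (rule uniform_limit_theorem[OF _ converges_on_uniform_limit[OF assms]])
    (auto intro!: always_eventually continuous_intros)

lemma monomial_at_replace:
  "monomial_at \<nu> (replace i z w) = w ^ (\<nu> $ i) * (\<Prod>l\<in>UNIV-{i}. z $ l ^ (\<nu> $ l))"
proof -
  have "monomial_at \<nu> (replace i z w) = w ^ (\<nu> $ i) * (\<Prod>l\<in>UNIV-{i}. (replace i z w) $ l ^ (\<nu> $ l))"
    unfolding monomial_at_def by (subst prod.remove[of _ i]) auto
  also have "(\<Prod>l\<in>UNIV-{i}. (replace i z w) $ l ^ (\<nu> $ l)) = (\<Prod>l\<in>UNIV-{i}. z $ l ^ (\<nu> $ l))"
    by (intro prod.cong) auto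
  finally show ?thesis .
qed

definition monomial_partial :: "'n \<Rightarrow> nat ^ 'n \<Rightarrow> complex ^ 'n \<Rightarrow> complex"
  where "monomial_partial i \<nu> z = of_nat (\<nu> $ i) * z $ i ^ (\<nu> $ i - 1) * (\<Prod>l\<in>UNIV-{i}. z $ l ^ (\<nu> $ l))"

lemma monomial_at_has_partial:
  "((\<lambda>w. monomial_at \<nu> (replace i z w)) has_field_derivative monomial_partial i \<nu> (replace i z w)) (at w)"
proof -
  have *: "(\<Prod>l\<in>UNIV-{i}. replace i z w $ l ^ (\<nu> $ l)) = (\<Prod>l\<in>UNIV-{i}. z $ l ^ (\<nu> $ l))"
    by (intro prod.cong) auto
  show ?thesis unfolding monomial_at_replace monomial_partial_def *
    by (auto intro!: derivative_eq_intros)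
qed

lemma replace_same [simp]: "replace i z (z $ i) = z"
  by (simp add: vec_eq_iff)

lemma mult_monomial_partial: "z $ i * monomial_partial i \<nu> z = of_nat (\<nu> $ i) * monomial_at \<nu> z"
proof (cases "\<nu> $ i")
  case (Suc a)
  show ?thesis
    using monomial_at_replace[where i = i and z = z and w = "z $ i" and \<nu> = \<nu>] by (simp add: monomial_partial_def Suc)
qed (simp add: monomial_partial_def)

lemma monomial_partial_add: "monomial_partial i (\<mu> + axis i 1) z = of_nat (\<mu> $ i + 1) * monomial_at \<mu> z"
proof -
  have "(\<Prod>l\<in>UNIV-{i}. z $ l ^ ((\<mu> + axis i 1) $ l)) = (\<Prod>l\<in>UNIV-{i}. z $ l ^ (\<mu> $ l))"
    by (intro prod.cong) (auto simp: axis_def)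
  then show ?thesis
    using monomial_at_replace[where i = i and z = z and w = "z $ i" and \<nu> = \<mu>] by (simp add: monomial_partial_def)
qed

text \<open>
  Termwise differentiation in one variable: the finite partial sums converge uniformly on a disc around
  \<open>z\<^sub>i\<close>, and Weierstrass' theorem, applied to the filter of finite subsets instead of a sequence,
  passes the derivative to the limit.
\<close>

lemma converges_on_partial:
  assumes conv: "converges_on r h c" and z: "\<And>l. norm (z $ l) < r"
  obtains D where "((\<lambda>w. h (replace i z w)) has_field_derivative D) (at (z $ i))"
    "((\<lambda>\<nu>. c \<nu> * monomial_partial i \<nu> z) has_sum D) UNIV"
proof -
  define \<rho> where "\<rho> = r - norm (z $ i)"
  have \<rho>: "0 < \<rho>" using z by (simp add: \<rho>_def)
  have sub: "replace i z w \<in> polydisc r" if "w \<in> cball (z $ i) \<rho>" for w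
  proof -
    have "norm w \<le> r"
      using that norm_triangle_ineq2[of w "z $ i"] by (simp add: \<rho>_def dist_norm norm_minus_commute)
    then show ?thesis using z by (auto simp: polydisc_def less_imp_le)
  qed
  have lim: "uniform_limit (cball (z $ i) \<rho>) (\<lambda>X w. \<Sum>\<nu>\<in>X. c \<nu> * monomial_at \<nu> (replace i z w))
      (\<lambda>w. h (replace i z w)) (finite_subsets_at_top UNIV)"
    by (rule uniform_limit_compose'[OF converges_on_uniform_limit[OF conv]]) (use sub in auto)
  have der: "((\<lambda>w. \<Sum>\<nu>\<in>X. c \<nu> * monomial_at \<nu> (replace i z w)) has_field_derivative
      (\<Sum>\<nu>\<in>X. c \<nu> * monomial_partial i \<nu> (replace i z w))) (at w)" for X w
    by (rule DERIV_sum[where f = "\<lambda>w \<nu>. c \<nu> * monomial_at \<nu> (replace i z w)"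
          and f' = "\<lambda>\<nu>. c \<nu> * monomial_partial i \<nu> (replace i z w)"])
      (rule DERIV_cmult[OF monomial_at_has_partial])
  obtain g' where g': "\<And>w. w \<in> ball (z $ i) \<rho> \<Longrightarrow>
      ((\<lambda>w. h (replace i z w)) has_field_derivative (g' w)) (at w) \<and>
      ((\<lambda>X. \<Sum>\<nu>\<in>X. c \<nu> * monomial_partial i \<nu> (replace i z w)) \<longlongrightarrow> g' w) (finite_subsets_at_top UNIV)"
  proof (rule has_complex_derivative_uniform_limit[OF always_eventually lim _ \<rho>])
    show "\<forall>X. continuous_on (cball (z $ i) \<rho>) (\<lambda>w. \<Sum>\<nu>\<in>X. c \<nu> * monomial_at \<nu> (replace i z w)) \<and>
      (\<forall>w\<in>ball (z $ i) \<rho>. ((\<lambda>w. \<Sum>\<nu>\<in>X. c \<nu> * monomial_at \<nu> (replace i z w)) has_field_derivative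
      (\<Sum>\<nu>\<in>X. c \<nu> * monomial_partial i \<nu> (replace i z w))) (at w))"
      using der by (auto intro!: continuous_at_imp_continuous_on DERIV_isCont[OF der])
  qed auto
  show ?thesis
    using g'[of "z $ i"] \<rho> that by (auto simp: has_sum_def)
qed

lemma gradient_nth: "gradient h z $ i = deriv (\<lambda>w. h (replace i z w)) (z $ i)"
  by (simp add: gradient_def)

lemma has_power_series_mult_gradient:
  assumes "has_power_series h c"
  shows "has_power_series (\<lambda>z. z $ i * gradient h z $ i) (\<lambda>\<nu>. of_nat (\<nu> $ i) * c \<nu>)"
proof -
  obtain r where r: "converges_on r h c" using assms has_power_series_iff by blast
  then have "0 < r" by (simp add: converges_on_def)
  then show ?thesis unfolding has_power_series_def
  proof (rule eventually_mono[OF eventually_in_polydisc])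
    fix z :: "complex^'a" assume z: "\<forall>i. norm (z $ i) < r"
    obtain D where D: "((\<lambda>w. h (replace i z w)) has_field_derivative D) (at (z $ i))"
      "((\<lambda>\<nu>. c \<nu> * monomial_partial i \<nu> z) has_sum D) UNIV"
      using converges_on_partial[OF r] z by blast
    have "((\<lambda>\<nu>. z $ i * (c \<nu> * monomial_partial i \<nu> z)) has_sum z $ i * D) UNIV"
      by (intro has_sum_cmult_right D)
    moreover have "z $ i * (c \<nu> * monomial_partial i \<nu> z) = of_nat (\<nu> $ i) * c \<nu> * monomial_at \<nu> z" for \<nu>
      using mult_monomial_partial[of z i \<nu>] by (simp add: mult_ac)
    ultimately show "((\<lambda>\<nu>. of_nat (\<nu> $ i) * c \<nu> * monomial_at \<nu> z) has_sum z $ i * gradient h z $ i) UNIV"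
      using DERIV_imp_deriv[OF D(1)] by (simp add: gradient_nth)
  qed
qed

text \<open>
  Shifting the index by the unit vector removes the terms without \<open>z\<^sub>i\<close>, which differentiation kills.
\<close>

lemma has_power_series_gradient:
  assumes "has_power_series h c"
  shows "has_power_series (\<lambda>z. gradient h z $ i) (\<lambda>\<mu>. of_nat (\<mu> $ i + 1) * c (\<mu> + axis i 1))"
proof -
  obtain r where r: "converges_on r h c" using assms has_power_series_iff by blast
  then have "0 < r" by (simp add: converges_on_def)
  then show ?thesis unfolding has_power_series_def
  proof (rule eventually_mono[OF eventually_in_polydisc])
    fix z :: "complex^'a" assume z: "\<forall>i. norm (z $ i) < r"
    obtain D where D: "((\<lambda>w. h (replace i z w)) has_field_derivative D) (at (z $ i))"
      "((\<lambda>\<nu>. c \<nu> * monomial_partial i \<nu> z) has_sum D) UNIV"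
      using converges_on_partial[OF r] z by blast
    have inj: "inj (\<lambda>\<mu>::nat^'a. \<mu> + axis i 1)"
      by (auto simp: inj_def vec_eq_iff)
    have zero: "c \<nu> * monomial_partial i \<nu> z = 0" if "\<nu> \<notin> range (\<lambda>\<mu>::nat^'a. \<mu> + axis i 1)" for \<nu>
    proof -
      have "\<nu> $ i = 0"
      proof (rule ccontr)
        assume "\<nu> $ i \<noteq> 0"
        then have "\<nu> = (\<chi> l. if l = i then \<nu> $ l - 1 else \<nu> $ l) + axis i 1"
          by (auto simp: vec_eq_iff axis_def)
        then show False using that by blast
      qed
      then show ?thesis by (simp add: monomial_partial_def)
    qed
    have "((\<lambda>\<nu>. c \<nu> * monomial_partial i \<nu> z) has_sum D) (range (\<lambda>\<mu>::nat^'a. \<mu> + axis i 1))"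
      by (rule has_sum_cong_neutral[THEN iffD1, OF _ _ _ D(2)]) (use zero in auto)
    then have "((\<lambda>\<mu>. c (\<mu> + axis i 1) * monomial_partial i (\<mu> + axis i 1) z) has_sum D) UNIV"
      by (subst (asm) has_sum_reindex[OF inj]) (simp add: o_def)
    then have "((\<lambda>\<mu>. c (\<mu> + axis i 1) * (of_nat (\<mu> $ i + 1) * monomial_at \<mu> z)) has_sum D) UNIV"
      unfolding monomial_partial_add .
    then show "((\<lambda>\<mu>. of_nat (\<mu> $ i + 1) * c (\<mu> + axis i 1) * monomial_at \<mu> z) has_sum gradient h z $ i) UNIV"
      using DERIV_imp_deriv[OF D(1)] by (simp add: gradient_nth mult_ac)
  qed
qed

lemma has_power_series_at_0:
  assumes "has_power_series h c" shows "h 0 = c 0"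
proof -
  have "((\<lambda>\<nu>. c \<nu> * monomial_at \<nu> 0) has_sum h 0) UNIV"
    using assms unfolding has_power_series_def by (rule eventually_nhds_x_imp_x)
  moreover have "monomial_at \<nu> 0 = 0" if "\<nu> \<noteq> 0" for \<nu> :: "nat^'a"
    using that by (auto simp: monomial_at_def vec_eq_iff)
  then have "((\<lambda>\<nu>. c \<nu> * monomial_at \<nu> 0) has_sum (\<Sum>\<nu>\<in>{0}. c \<nu> * monomial_at \<nu> 0)) UNIV"
    by (intro has_sum_finite_neutralI[where B = "{0}"]) auto
  ultimately have "h 0 = (\<Sum>\<nu>\<in>{0}. c \<nu> * monomial_at \<nu> 0)" using has_sum_unique by blast
  then show ?thesis by (simp add: monomial_at_def)
qed

text \<open>
  By induction on the degree of the index: the constant coefficient is the value at the origin, and every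
  other coefficient is, up to a nonzero integer factor, a coefficient of smaller degree of a partial
  derivative.
\<close>

lemma has_power_series_unique:
  assumes "has_power_series h c" "has_power_series h c'"
  shows "c = c'"
proof -
  have "c \<nu> = c' \<nu>" if "total_degree \<nu> = n" for n \<nu>
    using that assms
  proof (induction n arbitrary: h c c' \<nu>)
    case 0
    then have "\<nu> = 0" by (simp add: total_degree_def vec_eq_iff)
    then show ?case using 0 has_power_series_at_0 by metis
  next
    case (Suc n)
    have "\<exists>i. \<nu> $ i \<noteq> 0"
    proof (rule ccontr)
      assume "\<nexists>i. \<nu> $ i \<noteq> 0" then show False using Suc.prems(1) by (simp add: total_degree_def)
    qed
    then obtain i where i: "\<nu> $ i \<noteq> 0" ..
    define \<mu> where "\<mu> = (\<chi> l. if l = i then \<nu> $ l - 1 else \<nu> $ l)"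
    have \<mu>: "\<nu> = \<mu> + axis i 1" using i by (auto simp: vec_eq_iff axis_def \<mu>_def)
    have "total_degree \<mu> = n"
      using Suc.prems(1) by (simp add: \<mu> total_degree_add total_degree_axis)
    from Suc.IH[OF this has_power_series_gradient[OF Suc.prems(2)] has_power_series_gradient[OF Suc.prems(3)], of i]
    show ?case unfolding \<mu> by (simp del: of_nat_Suc of_nat_add)
  qed
  then show ?thesis by blast
qed

lemma coefficient_eq: "has_power_series h c \<Longrightarrow> coefficient h = c"
  unfolding coefficient_def using has_power_series_unique by blast

lemma has_power_series_coefficient:
  "analytic_at_origin h \<Longrightarrow> has_power_series h (coefficient h)"
  unfolding analytic_at_origin_def using coefficient_eq by metis

lemma has_power_series_isCont:
  assumes "has_power_series h c" shows "\<forall>\<^sub>F z in nhds 0. isCont h z"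
proof -
  obtain r where r: "converges_on r h c" using assms has_power_series_iff by blast
  then have "0 < r" by (simp add: converges_on_def)
  then have ev: "\<forall>\<^sub>F z in nhds (0::complex^'a). z \<in> polydisc r"
    by (rule eventually_mono[OF eventually_in_polydisc]) (auto simp: polydisc_def less_imp_le)
  then have "\<forall>\<^sub>F z in nhds (0::complex^'a). \<forall>\<^sub>F y in nhds z. y \<in> polydisc r"
    by (simp add: eventually_eventually)
  then show ?thesis
  proof (rule eventually_mono)
    fix z :: "complex^'a" assume "\<forall>\<^sub>F y in nhds z. y \<in> polydisc r"
    then have "z \<in> interior (polydisc r)" by (auto simp: eventually_nhds interior_def)
    then show "isCont h z"
      using converges_on_continuous[OF r] continuous_on_interior by blast
  qed
qed

lemma has_power_series_differentiable:
  assumes "has_power_series h c"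
  shows "\<forall>\<^sub>F z in nhds 0. ((\<lambda>w. h (replace i z w)) has_field_derivative gradient h z $ i) (at (z $ i))"
proof -
  obtain r where r: "converges_on r h c" using assms has_power_series_iff by blast
  then have "0 < r" by (simp add: converges_on_def)
  then show ?thesis
  proof (rule eventually_mono[OF eventually_in_polydisc])
    fix z :: "complex^'a" assume z: "\<forall>i. norm (z $ i) < r"
    obtain D where D: "((\<lambda>w. h (replace i z w)) has_field_derivative D) (at (z $ i))"
      using converges_on_partial[OF r] z by blast
    then show "((\<lambda>w. h (replace i z w)) has_field_derivative gradient h z $ i) (at (z $ i))"
      using DERIV_imp_deriv[OF D(1)] by (simp add: gradient_nth)
  qed
qed

section \<open>Newton polyhedra, axes and face functions\<close>

definition support :: "(complex ^ 'n \<Rightarrow> complex) \<Rightarrow> (nat ^ 'n) set"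
  where "support h = {\<nu>. coefficient h \<nu> \<noteq> 0}"

definition weight :: "real ^ 'n \<Rightarrow> nat ^ 'n \<Rightarrow> real"
  where "weight P \<nu> = P \<bullet> exponent_vector \<nu>"

definition minimal_on :: "real ^ 'n \<Rightarrow> (nat ^ 'n) set \<Rightarrow> (nat ^ 'n) set"
  where "minimal_on P K = {\<nu>\<in>K. \<forall>\<mu>\<in>K. weight P \<nu> \<le> weight P \<mu>}"

text \<open>
  For a convenient germ these finitely many monomials dominate all others near the origin: a monomial outside
  the box is a multiple of \<open>z\<^sub>i * z\<^sub>i ^ b\<^sub>i\<close> for some \<open>i\<close>.
\<close>

definition box_support :: "(complex ^ 'n \<Rightarrow> complex) \<Rightarrow> (nat ^ 'n) set"
  where "box_support h = {\<nu>\<in>support h. \<forall>i. \<nu> $ i \<le> axis_exponent h i}"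

lemma weight_sum: "weight P \<nu> = (\<Sum>i\<in>UNIV. P $ i * real (\<nu> $ i))"
  by (simp add: weight_def exponent_vector_def inner_vec_def)

lemma weight_axis: "weight P (axis j a) = P $ j * real a"
proof -
  have "weight P (axis j a) = (\<Sum>i\<in>UNIV. if i = j then P $ i * real a else 0)"
    unfolding weight_sum by (intro sum.cong) (auto simp: axis_def)
  then show ?thesis by simp
qed

lemma weight_ge_component:
  assumes "strictly_positive P" shows "P $ i * real (\<nu> $ i) \<le> weight P \<nu>"
  unfolding weight_sum
  by (rule member_le_sum) (use assms in \<open>auto simp: strictly_positive_def less_imp_le\<close>)

lemma generator_in_newton_polyhedron:
  assumes "\<nu> \<in> support h" "\<And>i. 0 \<le> x $ i"
  shows "exponent_vector \<nu> + x \<in> newton_polyhedron h"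
  unfolding newton_polyhedron_def by (rule hull_inc) (use assms in \<open>auto simp: support_def\<close>)

lemma newton_polyhedron_subset:
  assumes "convex C" "\<And>\<nu> x. \<nu> \<in> support h \<Longrightarrow> (\<And>i. 0 \<le> x $ i) \<Longrightarrow> exponent_vector \<nu> + x \<in> C"
  shows "newton_polyhedron h \<subseteq> C"
  unfolding newton_polyhedron_def by (rule hull_minimal) (use assms in \<open>auto simp: support_def\<close>)

lemma weight_lower_bound:
  assumes P: "strictly_positive P" and d: "\<And>\<nu>. \<nu> \<in> support h \<Longrightarrow> d \<le> weight P \<nu>"
    and y: "y \<in> newton_polyhedron h"
  shows "d \<le> P \<bullet> y"
proof -
  have "newton_polyhedron h \<subseteq> {y. P \<bullet> y \<ge> d}"
  proof (rule newton_polyhedron_subset)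
    fix \<nu> and x :: "real^'a" assume "\<nu> \<in> support h" "\<And>i. 0 \<le> x $ i"
    moreover from this have "0 \<le> P \<bullet> x"
      using P by (auto simp: inner_vec_def strictly_positive_def less_imp_le intro!: sum_nonneg)
    ultimately show "exponent_vector \<nu> + x \<in> {y. P \<bullet> y \<ge> d}"
      using d[of \<nu>] by (simp add: inner_add_right weight_def)
  qed (rule convex_halfspace_ge)
  then show ?thesis using y by blast
qed

lemma newton_polyhedron_nonneg:
  assumes "x \<in> newton_polyhedron h" shows "0 \<le> x $ i"
proof -
  have "newton_polyhedron h \<subseteq> {x. 0 \<le> x $ i}"
    by (rule newton_polyhedron_subset) (auto simp: convex_def exponent_vector_def)
  then show ?thesis using assms by blast
qed

text \<open>
  The points with nonnegative coordinates that either leave the axis or satisfy the bound form a convex set,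
  since a proper convex combination with a point off the axis stays off the axis. This set contains all
  generators of the polyhedron.
\<close>

lemma newton_polyhedron_axis_ge:
  assumes b: "\<And>a. axis j a \<in> support h \<Longrightarrow> b \<le> real a"
    and x: "axis j t \<in> newton_polyhedron h"
  shows "b \<le> t"
proof -
  define C where "C = {x :: real^'a. (\<forall>i. 0 \<le> x $ i) \<and> ((\<exists>i. i \<noteq> j \<and> 0 < x $ i) \<or> b \<le> x $ j)}"
  have "newton_polyhedron h \<subseteq> C"
  proof (rule newton_polyhedron_subset)
    show "convex C"
    proof (rule convexI)
      fix x y and u v :: real assume xy: "x \<in> C" "y \<in> C" and uv: "0 \<le> u" "0 \<le> v" "u + v = 1"
      have nn: "0 \<le> u * x $ i" "0 \<le> v * y $ i" for i using xy uv by (auto simp: C_def)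
      have "(\<exists>i. i \<noteq> j \<and> 0 < u * x $ i + v * y $ i) \<or> b \<le> u * x $ j + v * y $ j"
      proof (cases "u = 0 \<or> v = 0")
        case True then show ?thesis using xy uv by (auto simp: C_def)
      next
        case False
        then have uv': "0 < u" "0 < v" using uv by auto
        show ?thesis
        proof (cases "(\<exists>i. i \<noteq> j \<and> 0 < x $ i) \<or> (\<exists>i. i \<noteq> j \<and> 0 < y $ i)")
          case True
          then show ?thesis
            using uv' nn by (metis add_nonneg_pos add_pos_nonneg mult_pos_pos)
        next
          case False
          then have "b \<le> x $ j" "b \<le> y $ j" using xy by (auto simp: C_def)
          then have "u * b + v * b \<le> u * x $ j + v * y $ j"
            using uv by (intro add_mono mult_left_mono) auto
          then show ?thesis using uv by (simp flip: distrib_right)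
        qed
      qed
      then show "u *\<^sub>R x + v *\<^sub>R y \<in> C" using nn by (auto simp: C_def)
    qed
    fix \<nu> and x :: "real^'a" assume \<nu>: "\<nu> \<in> support h" and x: "\<And>i. 0 \<le> x $ i"
    show "exponent_vector \<nu> + x \<in> C"
    proof (cases "\<exists>i. i \<noteq> j \<and> \<nu> $ i \<noteq> 0")
      case True
      then show ?thesis using x by (auto simp: C_def exponent_vector_def add_pos_nonneg)
    next
      case False
      then have "\<nu> = axis j (\<nu> $ j)" by (auto simp: vec_eq_iff axis_def)
      then have "b \<le> real (\<nu> $ j)" using b \<nu> by metis
      then have "b \<le> real (\<nu> $ j) + x $ j" using x[of j] by linarith
      then show ?thesis using x by (auto simp: C_def exponent_vector_def)
    qed
  qed
  then have "axis j t \<in> C" using x by blast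
  then show ?thesis by (auto simp: C_def axis_def)
qed

lemma exponent_vector_axis: "exponent_vector (axis j a) = axis j (real a)"
  by (auto simp: exponent_vector_def vec_eq_iff axis_def)

lemma axis_in_newton_polyhedron:
  assumes "axis j a \<in> support h" "real a \<le> t" shows "axis j t \<in> newton_polyhedron h"
proof -
  have "exponent_vector (axis j a) + axis j (t - real a) \<in> newton_polyhedron h"
    by (rule generator_in_newton_polyhedron) (use assms in \<open>auto simp: axis_def\<close>)
  also have "exponent_vector (axis j a) + axis j (t - real a) = axis j t"
    unfolding exponent_vector_axis by (auto simp: vec_eq_iff axis_def)
  finally show ?thesis .
qed

text \<open>
  The part of the polyhedron on the axis is the ray that starts at the least exponent \<open>b\<close>. Its end point is
  a vertex of the polyhedron. A face that contains a later point of the ray contains the whole ray beyond it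
  and is not compact.
\<close>

lemma newton_boundary_axis:
  assumes a: "axis j a \<in> support h"
  shows "axis j t \<in> newton_boundary h \<longleftrightarrow> t = real (LEAST a. axis j a \<in> support h)"
proof -
  define b where "b = (LEAST a. axis j a \<in> support h)"
  have b: "axis j b \<in> support h" unfolding b_def using a by (rule LeastI)
  have b_le: "real b \<le> t" if "axis j t \<in> newton_polyhedron h" for t
    by (rule newton_polyhedron_axis_ge[OF _ that]) (simp add: b_def Least_le)
  have "t = real b" if t: "axis j t \<in> newton_boundary h"
  proof (rule ccontr)
    assume "t \<noteq> real b"
    obtain F where F: "F face_of newton_polyhedron h" "compact F" "axis j t \<in> F"
      using t by (auto simp: newton_boundary_def)
    then have "axis j t \<in> newton_polyhedron h" using face_of_imp_subset by blast
    then have t: "real b < t" using b_le \<open>t \<noteq> real b\<close> by fastforce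
    obtain B where B: "\<And>x. x \<in> F \<Longrightarrow> norm x \<le> B"
      using compact_imp_bounded[OF F(2)] unfolding bounded_iff by auto
    define s where "s = max (t + 1) (B + 1)"
    have s: "t < s" "B < s" by (auto simp: s_def)
    define u where "u = (t - real b) / (s - real b)"
    have u: "0 < u" "u < 1" "u * (s - real b) = t - real b"
      using t s by (auto simp: u_def divide_simps)
    have "axis j t \<in> open_segment (axis j (real b)) (axis j s)"
      unfolding in_segment
    proof (intro conjI exI[of _ u])
      show "axis j (real b) \<noteq> axis j s" using s t by (simp add: axis_eq_axis)
      show "axis j t = (1 - u) *\<^sub>R axis j (real b) + u *\<^sub>R axis j s"
        using u(3) by (auto simp: vec_eq_iff axis_def algebra_simps)
    qed (use u in auto)
    moreover have "axis j (real b) \<in> newton_polyhedron h" "axis j s \<in> newton_polyhedron h"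
      using axis_in_newton_polyhedron[OF b] s t by auto
    ultimately have "axis j s \<in> F" using F unfolding face_of_def by blast
    then have "norm (axis j s :: real^'a) \<le> B" by (rule B)
    moreover have "\<bar>(axis j s :: real^'a) $ j\<bar> \<le> norm (axis j s :: real^'a)"
      by (rule component_le_norm_cart)
    ultimately show False using s t by simp
  qed
  moreover have "axis j (real b) \<in> newton_boundary h"
  proof -
    have "x = axis j (real b) \<and> y = axis j (real b)"
      if xy: "x \<in> newton_polyhedron h" "y \<in> newton_polyhedron h" and seg: "axis j (real b) \<in> open_segment x y" for x y
    proof -
      obtain u where u: "0 < u" "u < 1" and eq: "axis j (real b) = (1 - u) *\<^sub>R x + u *\<^sub>R y"
        using seg unfolding in_segment by blast
      have nn: "0 \<le> (1 - u) * x $ i" "0 \<le> u * y $ i" for i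
        using u newton_polyhedron_nonneg[OF xy(1), of i] newton_polyhedron_nonneg[OF xy(2), of i] by auto
      have "x $ i = 0 \<and> y $ i = 0" if "i \<noteq> j" for i
      proof -
        have "(1 - u) * x $ i + u * y $ i = 0"
          using arg_cong[OF eq, of "\<lambda>v. v $ i"] that by (simp add: axis_def)
        then show ?thesis using nn[of i] u by (auto simp: add_nonneg_eq_0_iff)
      qed
      then have x: "x = axis j (x $ j)" and y: "y = axis j (y $ j)"
        by (auto simp: vec_eq_iff axis_def)
      have ge: "real b \<le> x $ j" "real b \<le> y $ j" using b_le xy x y by metis+
      have "(1 - u) * x $ j + u * y $ j = real b"
        using arg_cong[OF eq, of "\<lambda>v. v $ j"] by (simp add: axis_def)
      then have "(1 - u) * (x $ j - real b) + u * (y $ j - real b) = 0" by (simp add: algebra_simps)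
      moreover have "0 \<le> (1 - u) * (x $ j - real b)" "0 \<le> u * (y $ j - real b)" using ge u by auto
      ultimately have "x $ j = real b \<and> y $ j = real b"
        using u by (auto simp: add_nonneg_eq_0_iff)
      then show ?thesis using x y by metis
    qed
    then have "{axis j (real b)} face_of newton_polyhedron h"
      using axis_in_newton_polyhedron[OF b] by (auto simp: face_of_def)
    then show ?thesis unfolding newton_boundary_def
      by (intro UnionI[of "{axis j (real b)}"]) auto
  qed
  ultimately show ?thesis unfolding b_def by blast
qed

lemma axis_exponent_eq_Least:
  assumes "axis j a \<in> support h"
  shows "axis_exponent h j = (LEAST a. axis j a \<in> support h)"
  unfolding axis_exponent_def
proof (rule the_equality)
  show "axis j (real (LEAST a. axis j a \<in> support h)) \<in> newton_boundary h"
    using newton_boundary_axis[OF assms] by blast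
  show "b = (LEAST a. axis j a \<in> support h)" if "axis j (real b) \<in> newton_boundary h" for b
    using newton_boundary_axis[OF assms, THEN iffD1, OF that] of_nat_eq_iff by blast
qed

text \<open>
  In particular the exponent of a convenient germ on an axis is the exponent of a monomial that really occurs
  in its expansion.
\<close>

lemma convenient_support:
  assumes "convenient h" shows "axis j (axis_exponent h j) \<in> support h"
proof -
  obtain t where "axis j t \<in> newton_boundary h" using assms by (auto simp: convenient_def)
  then have t: "axis j t \<in> newton_polyhedron h"
    unfolding newton_boundary_def using face_of_imp_subset by blast
  have "\<exists>a. axis j a \<in> support h"
  proof (rule ccontr)
    assume "\<nexists>a. axis j a \<in> support h"
    then have "t + 1 \<le> t" by (intro newton_polyhedron_axis_ge[OF _ t]) auto
    then show False by simp
  qed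
  then obtain a where a: "axis j a \<in> support h" ..
  show ?thesis unfolding axis_exponent_eq_Least[OF a] using a by (rule LeastI)
qed

lemma finite_bounded_exponents: "finite {\<nu> :: nat ^ 'n. \<forall>i. \<nu> $ i \<le> b i}"
proof (rule finite_subset)
  show "{\<nu> :: nat ^ 'n. \<forall>i. \<nu> $ i \<le> b i} \<subseteq> vec_lambda ` (Pi\<^sub>E UNIV (\<lambda>i. {..b i}))"
  proof
    fix \<nu> :: "nat ^ 'n" assume "\<nu> \<in> {\<nu>. \<forall>i. \<nu> $ i \<le> b i}"
    then show "\<nu> \<in> vec_lambda ` (Pi\<^sub>E UNIV (\<lambda>i. {..b i}))"
      by (intro image_eqI[of _ _ "vec_nth \<nu>"]) auto
  qed
qed (intro finite_imageI finite_PiE; simp)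

lemma finite_box_support: "finite (box_support h)"
  by (rule finite_subset[OF _ finite_bounded_exponents[of "axis_exponent h"]]) (auto simp: box_support_def)

lemma axis_in_box_support:
  assumes "convenient h" shows "axis j (axis_exponent h j) \<in> box_support h"
proof -
  have "axis j (axis_exponent h j) $ i \<le> axis_exponent h i" for i by (simp add: axis_def)
  then show ?thesis using convenient_support[OF assms, of j] unfolding box_support_def by blast
qed

text \<open>
  Monomials outside the box never lie on a face with a strictly positive weight, so that face functions can be
  computed from the box alone.
\<close>

lemma weight_outside_box:
  assumes h: "convenient h" and P: "strictly_positive P" and \<nu>: "\<nu> \<in> support h" "\<nu> \<notin> box_support h"
  obtains \<mu> where "\<mu> \<in> box_support h" "weight P \<mu> < weight P \<nu>"
proof -
  obtain i where i: "axis_exponent h i < \<nu> $ i" using \<nu> by (auto simp: box_support_def not_le)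
  have "weight P (axis i (axis_exponent h i)) < P $ i * real (\<nu> $ i)"
    using P i by (simp add: weight_axis strictly_positive_def)
  also have "\<dots> \<le> weight P \<nu>" by (rule weight_ge_component[OF P])
  finally show ?thesis using that axis_in_box_support[OF h] by blast
qed

lemma minimal_on_nonempty:
  assumes "finite K" "K \<noteq> {}" shows "minimal_on P K \<noteq> {}"
proof -
  have "Min (weight P ` K) \<in> weight P ` K" using assms by (intro Min_in) auto
  then obtain \<nu> where "\<nu> \<in> K" "weight P \<nu> = Min (weight P ` K)" by auto
  then have "\<nu> \<in> minimal_on P K" using assms by (auto simp: minimal_on_def)
  then show ?thesis by blast
qed

text \<open>
  Positivity of the weight makes the index set of the defining sum finite; without this its value would be the
  default \<open>0\<close>. Indices on the face with a zero coefficient contribute nothing.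
\<close>

lemma face_function_eq:
  assumes h: "convenient h" and P: "strictly_positive P"
  shows "face_function P h z = (\<Sum>\<nu>\<in>minimal_on P (box_support h). coefficient h \<nu> * monomial_at \<nu> z)"
proof -
  let ?K = "box_support h" and ?W = "{\<nu>. exponent_vector \<nu> \<in> weight_face P h}"
  have K: "finite ?K" "?K \<subseteq> support h" "?K \<noteq> {}"
    using finite_box_support axis_in_box_support[OF h] by (auto simp: box_support_def)
  have in_NP: "exponent_vector \<nu> \<in> newton_polyhedron h" if "\<nu> \<in> support h" for \<nu>
    using generator_in_newton_polyhedron[OF that, of 0] by simp
  have finW: "finite ?W"
  proof -
    obtain \<kappa> where \<kappa>: "\<kappa> \<in> ?K" using K by blast
    have "?W \<subseteq> {\<nu>. \<forall>i. \<nu> $ i \<le> nat \<lceil>weight P \<kappa> / P $ i\<rceil>}"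
    proof safe
      fix \<nu> i assume "exponent_vector \<nu> \<in> weight_face P h"
      then have "weight P \<nu> \<le> weight P \<kappa>"
        using in_NP \<kappa> K by (auto simp: weight_face_def weight_def)
      then have "P $ i * real (\<nu> $ i) \<le> weight P \<kappa>"
        using weight_ge_component[OF P, of i \<nu>] by linarith
      then have "real (\<nu> $ i) \<le> weight P \<kappa> / P $ i"
        using P by (simp add: strictly_positive_def field_simps)
      then show "\<nu> $ i \<le> nat \<lceil>weight P \<kappa> / P $ i\<rceil>" by linarith
    qed
    then show ?thesis by (rule finite_subset[OF _ finite_bounded_exponents])
  qed
  have min: "\<exists>\<mu>\<in>minimal_on P ?K. weight P \<mu> \<le> weight P \<nu>" if \<nu>: "\<nu> \<in> support h" for \<nu>
  proof -
    obtain \<kappa> where \<kappa>: "\<kappa> \<in> minimal_on P ?K"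
      using minimal_on_nonempty[OF K(1,3), of P] by (meson ex_in_conv)
    have "\<exists>\<rho>\<in>?K. weight P \<rho> \<le> weight P \<nu>"
    proof (cases "\<nu> \<in> ?K")
      case True
      then show ?thesis by (rule bexI[rotated]) simp
    next
      case False
      obtain \<rho> where "\<rho> \<in> ?K" "weight P \<rho> < weight P \<nu>"
        by (rule weight_outside_box[OF h P \<nu> False])
      then show ?thesis by (intro bexI[of _ \<rho>]) simp_all
    qed
    then obtain \<rho> where \<rho>: "\<rho> \<in> ?K" "weight P \<rho> \<le> weight P \<nu>" by blast
    have "weight P \<kappa> \<le> weight P \<rho>" using \<kappa> \<rho>(1) by (simp add: minimal_on_def)
    then have "weight P \<kappa> \<le> weight P \<nu>" using \<rho>(2) by (rule order_trans)
    then show ?thesis using \<kappa> by blast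
  qed
  have sub: "minimal_on P ?K \<subseteq> ?W"
  proof
    fix \<nu> assume \<nu>: "\<nu> \<in> minimal_on P ?K"
    then have \<nu>s: "\<nu> \<in> support h" using K by (auto simp: minimal_on_def)
    have "weight P \<nu> \<le> P \<bullet> y" if "y \<in> newton_polyhedron h" for y
    proof (rule weight_lower_bound[OF P _ that])
      fix \<mu> assume "\<mu> \<in> support h"
      then obtain \<kappa> where "\<kappa> \<in> minimal_on P ?K" "weight P \<kappa> \<le> weight P \<mu>" using min by blast
      then show "weight P \<nu> \<le> weight P \<mu>" using \<nu> by (fastforce simp: minimal_on_def)
    qed
    then show "\<nu> \<in> ?W" using in_NP[OF \<nu>s] by (auto simp: weight_face_def weight_def)
  qed
  have zero: "coefficient h \<nu> = 0" if "\<nu> \<in> ?W - minimal_on P ?K" for \<nu>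
  proof (rule ccontr)
    assume "coefficient h \<nu> \<noteq> 0"
    then have \<nu>s: "\<nu> \<in> support h" by (simp add: support_def)
    have le: "weight P \<nu> \<le> weight P \<mu>" if "\<mu> \<in> support h" for \<mu>
      using \<open>\<nu> \<in> ?W - _\<close> in_NP[OF that] by (auto simp: weight_face_def weight_def)
    have "\<nu> \<in> ?K"
    proof (rule ccontr)
      assume "\<nu> \<notin> ?K"
      then obtain \<mu> where \<mu>: "\<mu> \<in> ?K" "weight P \<mu> < weight P \<nu>"
        by (rule weight_outside_box[OF h P \<nu>s])
      then have "\<mu> \<in> support h" using K(2) by blast
      from le[OF this] \<mu>(2) show False by simp
    qed
    then have "\<nu> \<in> minimal_on P ?K" using le K by (auto simp: minimal_on_def)
    then show False using that by blast
  qed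
  show ?thesis unfolding face_function_def
    by (rule sum.mono_neutral_right[OF finW sub]) (use zero in auto)
qed

lemma mult_gradient_face_function:
  assumes "convenient h" "strictly_positive P"
  shows "z $ i * gradient (face_function P h) z $ i =
    (\<Sum>\<nu>\<in>minimal_on P (box_support h). of_nat (\<nu> $ i) * coefficient h \<nu> * monomial_at \<nu> z)"
proof -
  let ?M = "minimal_on P (box_support h)"
  have "((\<lambda>w. \<Sum>\<nu>\<in>?M. coefficient h \<nu> * monomial_at \<nu> (replace i z w)) has_field_derivative
      (\<Sum>\<nu>\<in>?M. coefficient h \<nu> * monomial_partial i \<nu> (replace i z (z $ i)))) (at (z $ i))"
    by (rule DERIV_sum[where f = "\<lambda>w \<nu>. coefficient h \<nu> * monomial_at \<nu> (replace i z w)"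
          and f' = "\<lambda>\<nu>. coefficient h \<nu> * monomial_partial i \<nu> (replace i z (z $ i))"])
      (rule DERIV_cmult[OF monomial_at_has_partial])
  then have "gradient (face_function P h) z $ i = (\<Sum>\<nu>\<in>?M. coefficient h \<nu> * monomial_partial i \<nu> z)"
    unfolding gradient_nth face_function_eq[OF assms] replace_same by (rule DERIV_imp_deriv)
  moreover have "z $ i * (coefficient h \<nu> * monomial_partial i \<nu> z)
      = of_nat (\<nu> $ i) * coefficient h \<nu> * monomial_at \<nu> z" for \<nu>
    using mult_monomial_partial[of z i \<nu>] by (simp add: mult_ac)
  then have "(\<Sum>\<nu>\<in>?M. z $ i * (coefficient h \<nu> * monomial_partial i \<nu> z))
      = (\<Sum>\<nu>\<in>?M. of_nat (\<nu> $ i) * coefficient h \<nu> * monomial_at \<nu> z)"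
    by (rule sum.cong[OF refl])
  ultimately show ?thesis by (simp only: sum_distrib_left)
qed

section \<open>Degeneration of sequences in the torus\<close>

lemma bounded_family_subsequence:
  fixes x :: "'b \<Rightarrow> nat \<Rightarrow> 'c :: heine_borel"
  assumes "finite S" "\<And>s. s \<in> S \<Longrightarrow> bounded (range (x s))"
  shows "\<exists>r l. strict_mono r \<and> (\<forall>s\<in>S. (\<lambda>n. x s (r n)) \<longlonglongrightarrow> l s)"
  using assms
proof (induction S rule: finite_induct)
  case empty
  show ?case by (intro exI[of _ id]) (simp add: strict_mono_def)
next
  case (insert s S)
  then obtain r l where r: "strict_mono r" and l: "\<And>t. t \<in> S \<Longrightarrow> (\<lambda>n. x t (r n)) \<longlonglongrightarrow> l t"
    by auto
  have "bounded (range (x s))" using insert.prems by simp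
  then have "bounded (range (x s \<circ> r))" by (rule bounded_subset) auto
  then obtain m q where q: "strict_mono q" "((x s \<circ> r) \<circ> q) \<longlonglongrightarrow> m"
    using bounded_imp_convergent_subsequence by blast
  have rq: "strict_mono (r \<circ> q)" using r q(1) by (rule strict_mono_o)
  have "(\<lambda>n. x t ((r \<circ> q) n)) \<longlonglongrightarrow> (l(s := m)) t" if "t \<in> insert s S" for t
  proof (cases "t = s")
    case True then show ?thesis using q(2) by (simp add: o_def)
  next
    case False
    then have "((\<lambda>n. x t (r n)) \<circ> q) \<longlonglongrightarrow> l t" using l that q(1) by (intro LIMSEQ_subseq_LIMSEQ) auto
    then show ?thesis using False by (simp add: o_def)
  qed
  then show ?case using rq by blast
qed

lemma torus_log_sequence:
  fixes z :: "nat \<Rightarrow> complex ^ 'n"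
  assumes tor: "\<And>n. z n \<in> torus" and z0: "z \<longlonglongrightarrow> 0"
  shows "filterlim (\<lambda>n. - ln (norm (z n $ i))) at_top sequentially"
proof -
  have "(\<lambda>n. norm (z n $ i)) \<longlonglongrightarrow> norm ((0 :: complex ^ 'n) $ i)"
    by (intro tendsto_norm tendsto_vec_nth z0)
  then have "(\<lambda>n. norm (z n $ i)) \<longlonglongrightarrow> 0" by simp
  moreover have "\<forall>n. 0 < norm (z n $ i)" using tor by (simp add: torus_def)
  ultimately have "filterlim (\<lambda>n. norm (z n $ i)) (at_right 0) sequentially"
    by (auto simp: filterlim_at intro: always_eventually)
  then have "filterlim (\<lambda>n. ln (norm (z n $ i))) at_bot sequentially"
    by (rule filterlim_compose[OF ln_at_0])
  then show ?thesis by (simp add: filterlim_uminus_at_top)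
qed

lemma monomial_at_exp_scale:
  "monomial_at \<nu> (\<chi> i. of_real (exp (q $ i)) * z $ i) = of_real (exp (weight q \<nu>)) * monomial_at \<nu> z"
proof -
  have "exp (weight q \<nu>) = (\<Prod>i\<in>UNIV. exp (q $ i) ^ (\<nu> $ i))"
    by (simp add: weight_sum exp_sum mult.commute flip: exp_of_nat_mult)
  then show ?thesis
    by (simp add: monomial_at_def power_mult_distrib prod.distrib)
qed

lemma weight_diff_exponent: "weight p \<nu> - weight p \<mu> = p \<bullet> (exponent_vector \<nu> - exponent_vector \<mu>)"
  by (simp add: weight_def inner_diff_right)

text \<open>
  The orthogonal projection of \<open>p n\<close> to the span of \<open>G\<close> has coordinates in an orthonormal basis that are linear combinations of
  the numbers \<open>p n \<bullet> w\<close>, hence converges with them, although \<open>p n\<close> itself may diverge.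
\<close>

lemma convergent_projection:
  fixes p :: "nat \<Rightarrow> 'a :: euclidean_space"
  assumes G: "\<And>w. w \<in> G \<Longrightarrow> convergent (\<lambda>n. p n \<bullet> w)"
  obtains R L where "R \<longlonglongrightarrow> L" "\<And>n w. w \<in> G \<Longrightarrow> (p n - R n) \<bullet> w = 0"
proof -
  have span: "convergent (\<lambda>n. p n \<bullet> w)" if "w \<in> span G" for w
    using that
  proof (induction rule: span_induct)
    case base
    show ?case
      by (auto simp: subspace_def inner_add_right convergent_const intro: convergent_add convergent_mult)
  qed (use G in blast)
  obtain B where B: "B \<subseteq> span G" "pairwise orthogonal B" "\<And>x. x \<in> B \<Longrightarrow> norm x = 1"
    "independent B" "span B = span G"
    using orthonormal_basis_subspace[OF subspace_span[of G]] by metis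
  have fin: "finite B" using B(4) by (rule independent_imp_finite)
  define R where "R n = (\<Sum>e\<in>B. (p n \<bullet> e) *\<^sub>R e)" for n
  have "R \<longlonglongrightarrow> (\<Sum>e\<in>B. lim (\<lambda>n. p n \<bullet> e) *\<^sub>R e)" unfolding R_def
    using span B(1) by (intro tendsto_sum tendsto_scaleR tendsto_const) (auto simp: convergent_LIMSEQ_iff)
  moreover have "(p n - R n) \<bullet> w = 0" if "w \<in> G" for n w
  proof -
    have R: "R n \<bullet> e = p n \<bullet> e" if e: "e \<in> B" for e
    proof -
      have "R n \<bullet> e = (\<Sum>b\<in>B. if b = e then p n \<bullet> b else 0)"
        unfolding R_def inner_sum_left
      proof (rule sum.cong[OF refl])
        fix b assume b: "b \<in> B"
        show "(p n \<bullet> b) *\<^sub>R b \<bullet> e = (if b = e then p n \<bullet> b else 0)"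
          using B(2,3) b e by (auto simp: pairwise_def orthogonal_def norm_eq_1)
      qed
      then show ?thesis using fin e by simp
    qed
    have "w \<in> span B" using that B(5) span_base by blast
    then show ?thesis
    proof (induction rule: span_induct)
      case base show ?case by (rule subspace_hyperplane)
    qed (simp add: R inner_diff_left)
  qed
  ultimately show ?thesis using that by blast
qed

text \<open>
  This replaces the curve selection lemma. With \<open>P n = (- ln |z\<^sub>i|)\<^sub>i\<close> the sizes of monomials are
  \<open>exp (- weight (P n) \<nu>)\<close>. After passing to a subsequence each monomial has a limiting size relative to
  the largest one in its group; those with a positive limit are the surviving ones. Differences of surviving
  exponents have convergent pairing with \<open>P n\<close>, so \<open>P n\<close> is the sum of a convergent part \<open>R n\<close> and a part
  \<open>Q n\<close> orthogonal to all these differences. For one large index, \<open>Q n\<close> is a strictly positive weight that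
  is constant on the surviving exponents of each group and larger on the others; and rescaling \<open>z\<close> by \<open>exp (Q n)\<close> gives
  points with absolute values \<open>exp (- R n)\<close>, which accumulate inside the torus.
\<close>

lemma toric_limit:
  fixes z :: "nat \<Rightarrow> complex ^ 'n" and K :: "'b \<Rightarrow> (nat ^ 'n) set"
  assumes tor: "\<And>n. z n \<in> torus" and z0: "z \<longlonglongrightarrow> 0"
    and A: "finite A" and K: "\<And>a. a \<in> A \<Longrightarrow> finite (K a)" "\<And>a. a \<in> A \<Longrightarrow> K a \<noteq> {}"
  obtains r Q u d where "strict_mono r" "strictly_positive Q" "u \<in> torus"
    "\<And>a \<nu>. a \<in> A \<Longrightarrow> \<nu> \<in> K a \<Longrightarrow> (\<lambda>n. of_real (exp (d a n)) * monomial_at \<nu> (z (r n)))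
       \<longlonglongrightarrow> (if \<nu> \<in> minimal_on Q (K a) then monomial_at \<nu> u else 0)"
proof -
  define P where "P n = (\<chi> i. - ln (norm (z n $ i)))" for n
  define x where "x = (\<lambda>(a, \<nu>) n. exp (Min (weight (P n) ` K a) - weight (P n) \<nu>))"
  have x_bounds: "0 < x (a, \<nu>) n \<and> x (a, \<nu>) n \<le> 1" if "a \<in> A" "\<nu> \<in> K a" for a \<nu> n
    using K(1)[OF that(1)] that(2) by (simp add: x_def)
  have "bounded (range (x s))" if sAK: "s \<in> Sigma A K" for s
  proof -
    obtain a \<nu> where s: "s = (a, \<nu>)" "a \<in> A" "\<nu> \<in> K a" using sAK by auto
    show ?thesis unfolding bounded_iff s(1)
      using x_bounds[OF s(2,3)] by (auto intro!: exI[of _ 1] simp: abs_of_pos)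
  qed
  moreover have "finite (Sigma A K)" using A K(1) by blast
  ultimately obtain r l where r: "strict_mono r"
    and l: "\<And>s. s \<in> Sigma A K \<Longrightarrow> (\<lambda>n. x s (r n)) \<longlonglongrightarrow> l s"
    using bounded_family_subsequence[of "Sigma A K" x] by blast
  have l0: "0 \<le> l (a, \<nu>)" if "a \<in> A" "\<nu> \<in> K a" for a \<nu>
    using l[of "(a, \<nu>)"] that x_bounds[OF that]
    by (intro LIMSEQ_le_const[of "\<lambda>n. x (a, \<nu>) (r n)"]) (auto intro: less_imp_le)
  (* In each group the relative sizes sum to at least one, so at least one exponent survives. One such
     exponent serves as the reference point of the group. *)
  have "\<exists>\<nu>\<in>K a. 0 < l (a, \<nu>)" if a: "a \<in> A" for a
  proof (rule ccontr)
    assume "\<not> (\<exists>\<nu>\<in>K a. 0 < l (a, \<nu>))"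
    then have "l (a, \<nu>) = 0" if "\<nu> \<in> K a" for \<nu> using l0[OF a that] that by force
    then have "(\<lambda>n. \<Sum>\<nu>\<in>K a. x (a, \<nu>) (r n)) \<longlonglongrightarrow> (\<Sum>\<nu>\<in>K a. 0)"
      using l a by (intro tendsto_sum) (metis SigmaI)
    moreover have "1 \<le> (\<Sum>\<nu>\<in>K a. x (a, \<nu>) n)" for n
    proof -
      have "Min (weight (P n) ` K a) \<in> weight (P n) ` K a" using K a by (intro Min_in) auto
      then obtain \<nu> where \<nu>: "\<nu> \<in> K a" "weight (P n) \<nu> = Min (weight (P n) ` K a)" by auto
      then have "1 = x (a, \<nu>) n" by (simp add: x_def)
      also have "\<dots> \<le> (\<Sum>\<nu>\<in>K a. x (a, \<nu>) n)"
        using \<nu> K a x_bounds[OF a] by (intro member_le_sum) (auto intro: less_imp_le)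
      finally show ?thesis .
    qed
    ultimately have "1 \<le> (0::real)" by (intro LIMSEQ_le_const) auto
    then show False by simp
  qed
  then obtain \<nu>\<^sub>0 where \<nu>\<^sub>0: "\<And>a. a \<in> A \<Longrightarrow> \<nu>\<^sub>0 a \<in> K a" "\<And>a. a \<in> A \<Longrightarrow> 0 < l (a, \<nu>\<^sub>0 a)"
    by metis
  define w where "w a \<nu> = exponent_vector \<nu> - exponent_vector (\<nu>\<^sub>0 a)" for a \<nu>
  have ratio: "exp (- (P n \<bullet> w a \<nu>)) = x (a, \<nu>) n / x (a, \<nu>\<^sub>0 a) n" for a \<nu> n
    by (simp add: w_def x_def weight_def inner_diff_right flip: exp_diff)
  have ratio_lim: "(\<lambda>n. exp (- (P (r n) \<bullet> w a \<nu>))) \<longlonglongrightarrow> l (a, \<nu>) / l (a, \<nu>\<^sub>0 a)"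
    if "a \<in> A" "\<nu> \<in> K a" for a \<nu>
    unfolding ratio using l \<nu>\<^sub>0 that by (intro tendsto_divide) (auto simp: less_imp_neq[symmetric])
  (* The differences of surviving exponents; their pairing with P converges. *)
  define G where "G = {w a \<nu> | a \<nu>. a \<in> A \<and> \<nu> \<in> K a \<and> 0 < l (a, \<nu>)}"
  have conv: "convergent (\<lambda>n. P (r n) \<bullet> v)" if vG: "v \<in> G" for v
  proof -
    obtain a \<nu> where v: "v = w a \<nu>" "a \<in> A" "\<nu> \<in> K a" "0 < l (a, \<nu>)" using vG by (auto simp: G_def)
    have "(\<lambda>n. - ln (exp (- (P (r n) \<bullet> w a \<nu>)))) \<longlonglongrightarrow> - ln (l (a, \<nu>) / l (a, \<nu>\<^sub>0 a))"
      using v \<nu>\<^sub>0(2)[OF v(2)] by (intro tendsto_minus tendsto_ln ratio_lim) auto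
    then show ?thesis by (auto simp: v convergent_def)
  qed
  obtain R L where R: "R \<longlonglongrightarrow> L" "\<And>n v. v \<in> G \<Longrightarrow> (P (r n) - R n) \<bullet> v = 0"
    using convergent_projection[of G "\<lambda>n. P (r n)", OF conv] by blast
  define Q where "Q n = P (r n) - R n" for n
  define y where "y n = (\<chi> i. of_real (exp (Q n $ i)) * z (r n) $ i)" for n
  have norm_y: "norm (y n $ i) = exp (- (R n $ i))" for n i
  proof -
    have "norm (z (r n) $ i) = exp (- (P (r n) $ i))" using tor[of "r n"] by (simp add: P_def torus_def)
    then show ?thesis by (simp add: y_def norm_mult Q_def flip: exp_add)
  qed
  have norm_y_lim: "(\<lambda>n. norm (y n $ i)) \<longlonglongrightarrow> exp (- (L $ i))" for i
    unfolding norm_y by (intro tendsto_intros R)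
  have "bounded (range (\<lambda>n. y n $ i))" for i
  proof -
    have "bounded (range (\<lambda>n. norm (y n $ i)))"
      using norm_y_lim by (rule convergent_imp_bounded)
    then show ?thesis by (auto simp: bounded_iff)
  qed
  then obtain q u' where q: "strict_mono q" and u': "\<And>i. (\<lambda>n. y (q n) $ i) \<longlonglongrightarrow> u' i"
    using bounded_family_subsequence[of UNIV "\<lambda>i n. y n $ i"] by auto
  define u where "u = (\<chi> i. u' i)"
  have yu: "(\<lambda>n. y (q n)) \<longlonglongrightarrow> u"
    using u' by (intro vec_tendstoI) (simp add: u_def)
  have norm_u: "norm (u $ i) = exp (- (L $ i))" for i
  proof (rule LIMSEQ_unique)
    show "(\<lambda>n. norm (y (q n) $ i)) \<longlonglongrightarrow> norm (u $ i)" using u' by (auto simp: u_def intro: tendsto_norm)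
    show "(\<lambda>n. norm (y (q n) $ i)) \<longlonglongrightarrow> exp (- (L $ i))"
      using LIMSEQ_subseq_LIMSEQ[OF norm_y_lim q] by (simp add: o_def)
  qed
  have u: "u \<in> torus" unfolding torus_def
  proof (intro CollectI allI)
    fix i show "u $ i \<noteq> 0" using norm_u[of i] exp_gt_zero[of "- (L $ i)"] by force
  qed
  have Q_top: "filterlim (\<lambda>n. Q n $ i) at_top sequentially" for i
  proof -
    have "filterlim (\<lambda>n. P (r n) $ i) at_top sequentially"
      using filterlim_compose[OF torus_log_sequence[OF tor z0, of i] filterlim_subseq[OF r]]
      by (simp add: P_def)
    moreover have "(\<lambda>n. - R n $ i) \<longlonglongrightarrow> - L $ i" by (intro tendsto_intros R)
    ultimately have "filterlim (\<lambda>n. - R n $ i + P (r n) $ i) at_top sequentially"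
      by (intro filterlim_tendsto_add_at_top)
    then show ?thesis by (simp add: Q_def)
  qed
  have Q0: "Q n \<bullet> w a \<nu> = 0" if "a \<in> A" "\<nu> \<in> K a" "0 < l (a, \<nu>)" for a \<nu> n
    unfolding Q_def by (rule R(2)) (use that in \<open>auto simp: G_def\<close>)
  have Qlim: "(\<lambda>n. exp (- (Q n \<bullet> w a \<nu>))) \<longlonglongrightarrow> 0" if a: "a \<in> A" "\<nu> \<in> K a" and l: "l (a, \<nu>) = 0" for a \<nu>
  proof -
    have "(\<lambda>n. exp (- (P (r n) \<bullet> w a \<nu>)) * exp (R n \<bullet> w a \<nu>)) \<longlonglongrightarrow> l (a, \<nu>) / l (a, \<nu>\<^sub>0 a) * exp (L \<bullet> w a \<nu>)"
      by (intro tendsto_intros ratio_lim[OF a] R)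
    then show ?thesis by (simp add: l Q_def inner_diff_left flip: exp_add)
  qed
  (* Finitely many strict inequalities hold for all large n; any such index gives the weight of the face. *)
  have "\<forall>\<^sub>F n in sequentially. (\<forall>i. 0 < Q n $ i) \<and>
      (\<forall>(a, \<nu>)\<in>{(a, \<nu>)\<in>Sigma A K. l (a, \<nu>) = 0}. exp (- (Q n \<bullet> w a \<nu>)) < 1)"
  proof (intro eventually_conj eventually_all_finite eventually_ball_finite ballI)
    show "\<forall>\<^sub>F n in sequentially. 0 < Q n $ i" for i
      using Q_top[of i] by (simp add: filterlim_at_top_dense)
    show "finite {(a, \<nu>)\<in>Sigma A K. l (a, \<nu>) = 0}"
      by (rule finite_subset[OF _ \<open>finite (Sigma A K)\<close>]) auto
    fix s assume "s \<in> {(a, \<nu>)\<in>Sigma A K. l (a, \<nu>) = 0}"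
    then obtain a \<nu> where s: "s = (a, \<nu>)" "a \<in> A" "\<nu> \<in> K a" "l (a, \<nu>) = 0" by auto
    show "\<forall>\<^sub>F n in sequentially. case s of (a, \<nu>) \<Rightarrow> exp (- (Q n \<bullet> w a \<nu>)) < 1"
      using order_tendstoD(2)[OF Qlim[OF s(2-4)], of 1] by (simp add: s(1))
  qed
  then obtain N where N: "\<And>i. 0 < Q N $ i"
    "\<And>a \<nu>. a \<in> A \<Longrightarrow> \<nu> \<in> K a \<Longrightarrow> l (a, \<nu>) = 0 \<Longrightarrow> exp (- (Q N \<bullet> w a \<nu>)) < 1"
    unfolding eventually_sequentially by fastforce
  have weight_w: "weight (Q n) \<nu> - weight (Q n) (\<nu>\<^sub>0 a) = Q n \<bullet> w a \<nu>" for n a \<nu>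
    by (simp add: w_def weight_diff_exponent)
  have cases: "weight (Q N) \<nu> = weight (Q N) (\<nu>\<^sub>0 a) \<and> 0 < l (a, \<nu>) \<or>
      weight (Q N) (\<nu>\<^sub>0 a) < weight (Q N) \<nu> \<and> l (a, \<nu>) = 0" if "a \<in> A" "\<nu> \<in> K a" for a \<nu>
    using Q0[OF that, of N] N(2)[OF that] l0[OF that] weight_w[of N \<nu> a] by force
  have min: "\<nu> \<in> minimal_on (Q N) (K a) \<longleftrightarrow> 0 < l (a, \<nu>)" if a: "a \<in> A" "\<nu> \<in> K a" for a \<nu>
  proof -
    have ge: "weight (Q N) (\<nu>\<^sub>0 a) \<le> weight (Q N) \<mu>" if "\<mu> \<in> K a" for \<mu>
      using cases[OF a(1) that] by linarith
    show ?thesis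
      using cases[OF a] a ge \<nu>\<^sub>0(1)[OF a(1)] unfolding minimal_on_def by fastforce
  qed
  define d where "d a n = weight (Q (q n)) (\<nu>\<^sub>0 a)" for a n
  show ?thesis
  proof (rule that)
    show "strict_mono (r \<circ> q)" using r q by (rule strict_mono_o)
    show "strictly_positive (Q N)" using N(1) by (simp add: strictly_positive_def)
    show "u \<in> torus" by (rule u)
    fix a \<nu> assume a: "a \<in> A" "\<nu> \<in> K a"
    have eq: "of_real (exp (d a n)) * monomial_at \<nu> (z ((r \<circ> q) n))
        = of_real (exp (- (Q (q n) \<bullet> w a \<nu>))) * monomial_at \<nu> (y (q n))" for n
    proof -
      have "monomial_at \<nu> (y (q n)) = of_real (exp (weight (Q (q n)) \<nu>)) * monomial_at \<nu> (z (r (q n)))"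
        unfolding y_def by (rule monomial_at_exp_scale)
      moreover have "exp (d a n) = exp (- (Q (q n) \<bullet> w a \<nu>)) * exp (weight (Q (q n)) \<nu>)"
        by (simp add: d_def flip: weight_w exp_add)
      ultimately show ?thesis by simp
    qed
    have mono: "(\<lambda>n. monomial_at \<nu> (y (q n))) \<longlonglongrightarrow> monomial_at \<nu> u"
      unfolding monomial_at_def by (intro tendsto_prod tendsto_power tendsto_vec_nth yu)
    have "(\<lambda>n. of_real (exp (- (Q (q n) \<bullet> w a \<nu>))) :: complex) \<longlonglongrightarrow> (if 0 < l (a, \<nu>) then 1 else 0)"
    proof (cases "0 < l (a, \<nu>)")
      case True then show ?thesis using Q0[OF a] by simp
    next
      case False
      then have "l (a, \<nu>) = 0" using l0[OF a] by simp
      then have "(\<lambda>n. of_real (exp (- (Q (q n) \<bullet> w a \<nu>))) :: complex) \<longlonglongrightarrow> of_real 0"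
        using LIMSEQ_subseq_LIMSEQ[OF Qlim[OF a] q] by (intro tendsto_of_real) (simp add: o_def)
      then show ?thesis using False by simp
    qed
    then have "(\<lambda>n. of_real (exp (- (Q (q n) \<bullet> w a \<nu>))) * monomial_at \<nu> (y (q n)))
        \<longlonglongrightarrow> (if 0 < l (a, \<nu>) then 1 else 0) * monomial_at \<nu> u"
      by (intro tendsto_mult mono)
    then show "(\<lambda>n. of_real (exp (d a n)) * monomial_at \<nu> (z ((r \<circ> q) n)))
        \<longlonglongrightarrow> (if \<nu> \<in> minimal_on (Q N) (K a) then monomial_at \<nu> u else 0)"
      unfolding eq min[OF a] by (simp split: if_splits)
  qed
qed

section \<open>Convergence to the initial forms\<close>

definition box_size :: "(complex ^ 'n \<Rightarrow> complex) \<Rightarrow> complex ^ 'n \<Rightarrow> real"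
  where "box_size h z = (\<Sum>\<nu>\<in>box_support h. norm (monomial_at \<nu> z))"

lemma monomial_le_box_size:
  "\<nu> \<in> box_support h \<Longrightarrow> norm (monomial_at \<nu> z) \<le> box_size h z"
  unfolding box_size_def by (rule member_le_sum) (auto simp: finite_box_support)

lemma box_size_nonneg: "0 \<le> box_size h z"
  unfolding box_size_def by (intro sum_nonneg) simp

text \<open>
  Factor \<open>z ^ \<nu> = z ^ \<mu> * z\<^sub>i ^ b\<^sub>i * z\<^sub>i\<close>: the second factor is bounded by the box, the third by the norm
  of \<open>z\<close>, and the first by the polydisc radius. The sum over \<open>i\<close> only serves to make the constant independent
  of \<open>\<nu>\<close>.
\<close>

lemma norm_monomial_outside_box:
  assumes h: "convenient h" and r: "0 < r" and z: "z \<in> polydisc r"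
    and \<nu>: "\<nu> \<in> support h" "\<nu> \<notin> box_support h"
  shows "norm (monomial_at \<nu> z)
    \<le> r ^ total_degree \<nu> * ((\<Sum>i\<in>UNIV. 1 / r ^ (axis_exponent h i + 1)) * norm z * box_size h z)"
proof -
  obtain i where i: "axis_exponent h i < \<nu> $ i" using \<nu> by (auto simp: box_support_def not_le)
  define b where "b = axis_exponent h i"
  define \<mu> where "\<mu> = (\<chi> l. if l = i then \<nu> $ l - (b + 1) else \<nu> $ l)"
  have \<nu>_eq: "\<nu> = \<mu> + (axis i b + axis i 1)" using i by (auto simp: \<mu>_def b_def vec_eq_iff axis_def)
  have deg: "total_degree \<nu> = total_degree \<mu> + (b + 1)"
    by (simp only: \<nu>_eq total_degree_add total_degree_axis)
  have "norm (monomial_at \<nu> z) = norm (monomial_at \<mu> z) * (norm (monomial_at (axis i b) z) * norm (z $ i))"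
    by (simp add: \<nu>_eq monomial_at_add norm_mult monomial_at_axis[of i 1, simplified])
  also have "\<dots> \<le> r ^ total_degree \<mu> * (box_size h z * norm z)"
    using norm_monomial_at_le[OF z] monomial_le_box_size[OF axis_in_box_support[OF h]] box_size_nonneg r
    by (intro mult_mono) (auto simp: b_def Finite_Cartesian_Product.norm_nth_le)
  also have "r ^ total_degree \<mu> = r ^ total_degree \<nu> * (1 / r ^ (b + 1))"
    using r unfolding deg power_add[of r "total_degree \<mu>"] by simp
  also have "r ^ total_degree \<nu> * (1 / r ^ (b + 1)) * (box_size h z * norm z)
      = r ^ total_degree \<nu> * (1 / r ^ (b + 1) * norm z * box_size h z)" by simp
  also have "\<dots> \<le> r ^ total_degree \<nu> * ((\<Sum>i\<in>UNIV. 1 / r ^ (axis_exponent h i + 1)) * norm z * box_size h z)"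
    unfolding b_def using r box_size_nonneg[of h z]
    by (intro mult_left_mono mult_right_mono member_le_sum[of i]) auto
  finally show ?thesis .
qed

text \<open>
  The coefficients \<open>a\<close> are allowed to differ from those of \<open>h\<close>, because the estimate is needed for
  \<open>z\<^sub>i \<partial>\<^sub>i h\<close> as well as for \<open>h\<close>.
\<close>

lemma box_tail_bound:
  assumes h: "convenient h" and H: "has_power_series H a" and supp: "\<And>\<nu>. a \<nu> \<noteq> 0 \<Longrightarrow> \<nu> \<in> support h"
  shows "\<exists>C. \<forall>\<^sub>F z in nhds 0. norm (H z - (\<Sum>\<nu>\<in>box_support h. a \<nu> * monomial_at \<nu> z))
    \<le> C * norm z * box_size h z"
proof -
  obtain r where conv: "converges_on r H a" using H has_power_series_iff by blast
  then have r: "0 < r" and sm: "(\<lambda>\<nu>. norm (a \<nu>) * r ^ total_degree \<nu>) summable_on UNIV"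
    by (simp_all add: converges_on_def)
  let ?K = "box_support h"
  define D where "D = (\<Sum>i\<in>UNIV. 1 / r ^ (axis_exponent h i + 1))"
  define S where "S = infsum (\<lambda>\<nu>. norm (a \<nu>) * r ^ total_degree \<nu>) (UNIV - ?K)"
  have S: "((\<lambda>\<nu>. norm (a \<nu>) * r ^ total_degree \<nu>) has_sum S) (UNIV - ?K)"
    unfolding S_def by (intro has_sum_infsum summable_on_subset_banach[OF sm]) auto
  have bound: "norm (H z - (\<Sum>\<nu>\<in>?K. a \<nu> * monomial_at \<nu> z)) \<le> S * D * norm z * box_size h z"
    if z: "z \<in> polydisc r" for z
  proof -
    have "((\<lambda>\<nu>. a \<nu> * monomial_at \<nu> z) has_sum H z) UNIV"
      using conv z by (simp add: converges_on_def)
    then have diff: "((\<lambda>\<nu>. a \<nu> * monomial_at \<nu> z) has_sum (H z - (\<Sum>\<nu>\<in>?K. a \<nu> * monomial_at \<nu> z))) (UNIV - ?K)"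
      by (rule has_sum_Diff) (auto intro: has_sum_finite finite_box_support)
    have "norm (H z - (\<Sum>\<nu>\<in>?K. a \<nu> * monomial_at \<nu> z)) \<le> S * (D * norm z * box_size h z)"
    proof (rule norm_infsum_le[OF diff has_sum_cmult_left[OF S]])
      fix \<nu> assume "\<nu> \<in> UNIV - ?K"
      then have "\<nu> \<notin> ?K" by simp
      show "norm (a \<nu> * monomial_at \<nu> z) \<le> norm (a \<nu>) * r ^ total_degree \<nu> * (D * norm z * box_size h z)"
      proof (cases "a \<nu> = 0")
        case False
        then have "\<nu> \<in> support h" by (rule supp)
        from norm_monomial_outside_box[OF h r z this \<open>\<nu> \<notin> ?K\<close>]
        have "norm (monomial_at \<nu> z) \<le> r ^ total_degree \<nu> * (D * norm z * box_size h z)"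
          by (simp only: D_def)
        from mult_left_mono[OF this, of "norm (a \<nu>)"]
        show ?thesis by (simp add: norm_mult mult.assoc)
      qed simp
    qed
    then show ?thesis by (simp add: mult_ac)
  qed
  have "\<forall>\<^sub>F z in nhds (0::complex^'a). z \<in> polydisc r"
    by (rule eventually_mono[OF eventually_in_polydisc[OF r]]) (auto simp: polydisc_def less_imp_le)
  then have "\<forall>\<^sub>F z in nhds 0. norm (H z - (\<Sum>\<nu>\<in>?K. a \<nu> * monomial_at \<nu> z)) \<le> (S * D) * norm z * box_size h z"
    by (rule eventually_mono) (rule bound)
  then show ?thesis by blast
qed

text \<open>
  The tail outside the box is smaller than the box by a factor that tends to zero, so the limit sees only the
  monomials in the box.
\<close>

lemma initial_form_limit:
  fixes z :: "nat \<Rightarrow> complex ^ 'n"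
  assumes h: "convenient h" and H: "has_power_series H a" and supp: "\<And>\<nu>. a \<nu> \<noteq> 0 \<Longrightarrow> \<nu> \<in> support h"
    and z0: "z \<longlonglongrightarrow> 0" and e: "\<And>n. 0 \<le> e n"
    and lim: "\<And>\<nu>. \<nu> \<in> box_support h \<Longrightarrow> (\<lambda>n. of_real (e n) * monomial_at \<nu> (z n)) \<longlonglongrightarrow> w \<nu>"
  shows "(\<lambda>n. of_real (e n) * H (z n)) \<longlonglongrightarrow> (\<Sum>\<nu>\<in>box_support h. a \<nu> * w \<nu>)"
proof -
  let ?K = "box_support h"
  obtain C where C: "\<forall>\<^sub>F x in nhds 0. norm (H x - (\<Sum>\<nu>\<in>?K. a \<nu> * monomial_at \<nu> x)) \<le> C * norm x * box_size h x"
    using box_tail_bound[OF h H supp] by blast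
  have "(\<lambda>n. of_real (e n) * (H (z n) - (\<Sum>\<nu>\<in>?K. a \<nu> * monomial_at \<nu> (z n)))) \<longlonglongrightarrow> 0"
  proof (rule Lim_null_comparison)
    have "\<forall>\<^sub>F n in sequentially. norm (H (z n) - (\<Sum>\<nu>\<in>?K. a \<nu> * monomial_at \<nu> (z n)))
        \<le> C * norm (z n) * box_size h (z n)"
      using z0 C by (rule filterlim_iff[THEN iffD1, rule_format])
    then show "\<forall>\<^sub>F n in sequentially. norm (of_real (e n) * (H (z n) - (\<Sum>\<nu>\<in>?K. a \<nu> * monomial_at \<nu> (z n))))
        \<le> C * norm (z n) * (\<Sum>\<nu>\<in>?K. norm (of_real (e n) * monomial_at \<nu> (z n)))"
    proof (rule eventually_mono)
      fix n assume *: "norm (H (z n) - (\<Sum>\<nu>\<in>?K. a \<nu> * monomial_at \<nu> (z n))) \<le> C * norm (z n) * box_size h (z n)"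
      have eq: "(\<Sum>\<nu>\<in>?K. norm (of_real (e n) * monomial_at \<nu> (z n))) = e n * box_size h (z n)"
        using e[of n] by (simp add: norm_mult box_size_def sum_distrib_left)
      show "norm (of_real (e n) * (H (z n) - (\<Sum>\<nu>\<in>?K. a \<nu> * monomial_at \<nu> (z n))))
        \<le> C * norm (z n) * (\<Sum>\<nu>\<in>?K. norm (of_real (e n) * monomial_at \<nu> (z n)))"
        unfolding eq using mult_left_mono[OF * e[of n]] e[of n] by (simp add: norm_mult mult_ac)
    qed
    have "(\<lambda>n. C * norm (z n) * (\<Sum>\<nu>\<in>?K. norm (of_real (e n) * monomial_at \<nu> (z n))))
        \<longlonglongrightarrow> C * norm (0 :: complex ^ 'n) * (\<Sum>\<nu>\<in>?K. norm (w \<nu>))"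
      by (intro tendsto_mult tendsto_const tendsto_norm z0 tendsto_sum lim)
    then show "(\<lambda>n. C * norm (z n) * (\<Sum>\<nu>\<in>?K. norm (of_real (e n) * monomial_at \<nu> (z n)))) \<longlonglongrightarrow> 0"
      by simp
  qed
  moreover have "(\<lambda>n. \<Sum>\<nu>\<in>?K. a \<nu> * (of_real (e n) * monomial_at \<nu> (z n))) \<longlonglongrightarrow> (\<Sum>\<nu>\<in>?K. a \<nu> * w \<nu>)"
    by (intro tendsto_sum tendsto_mult tendsto_const lim)
  ultimately have "(\<lambda>n. of_real (e n) * (H (z n) - (\<Sum>\<nu>\<in>?K. a \<nu> * monomial_at \<nu> (z n)))
      + (\<Sum>\<nu>\<in>?K. a \<nu> * (of_real (e n) * monomial_at \<nu> (z n)))) \<longlonglongrightarrow> 0 + (\<Sum>\<nu>\<in>?K. a \<nu> * w \<nu>)"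
    by (rule tendsto_add)
  moreover have "of_real (e n) * (H (z n) - (\<Sum>\<nu>\<in>?K. a \<nu> * monomial_at \<nu> (z n)))
      + (\<Sum>\<nu>\<in>?K. a \<nu> * (of_real (e n) * monomial_at \<nu> (z n))) = of_real (e n) * H (z n)" for n
    by (simp add: right_diff_distrib sum_distrib_left mult_ac)
  ultimately show ?thesis by simp
qed

lemma initial_form_limit_face:
  fixes z :: "nat \<Rightarrow> complex ^ 'n"
  assumes h: "analytic_at_origin h" "convenient h" and Q: "strictly_positive Q"
    and z0: "z \<longlonglongrightarrow> 0" and e: "\<And>n. 0 \<le> e n"
    and lim: "\<And>\<nu>. \<nu> \<in> box_support h \<Longrightarrow> (\<lambda>n. of_real (e n) * monomial_at \<nu> (z n))
       \<longlonglongrightarrow> (if \<nu> \<in> minimal_on Q (box_support h) then monomial_at \<nu> u else 0)"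
  shows "(\<lambda>n. of_real (e n) * h (z n)) \<longlonglongrightarrow> face_function Q h u"
    and "(\<lambda>n. of_real (e n) * (z n $ i * gradient h (z n) $ i)) \<longlonglongrightarrow> u $ i * gradient (face_function Q h) u $ i"
proof -
  let ?K = "box_support h"
  have sum_eq: "(\<Sum>\<nu>\<in>?K. a \<nu> * (if \<nu> \<in> minimal_on Q ?K then monomial_at \<nu> u else 0))
      = (\<Sum>\<nu>\<in>minimal_on Q ?K. a \<nu> * monomial_at \<nu> u)" for a
    by (rule sum.mono_neutral_cong_right) (auto simp: finite_box_support minimal_on_def)
  have ps: "has_power_series h (coefficient h)" by (rule has_power_series_coefficient[OF h(1)])
  show "(\<lambda>n. of_real (e n) * h (z n)) \<longlonglongrightarrow> face_function Q h u"
    using initial_form_limit[OF h(2) ps _ z0 e lim]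
    unfolding sum_eq face_function_eq[OF h(2) Q] by (simp add: support_def)
  show "(\<lambda>n. of_real (e n) * (z n $ i * gradient h (z n) $ i)) \<longlonglongrightarrow> u $ i * gradient (face_function Q h) u $ i"
    using initial_form_limit[OF h(2) has_power_series_mult_gradient[OF ps] _ z0 e lim]
    unfolding sum_eq mult_gradient_face_function[OF h(2) Q] by (simp add: support_def)
qed

text \<open>
  All exponents on the face have the same weight, which is positive because the constant monomial does not
  occur.
\<close>

lemma face_function_Euler:
  assumes h: "convenient h" and Q: "strictly_positive Q" and h0: "0 \<notin> support h"
  obtains D where "0 < D" "\<And>u. (\<Sum>i\<in>UNIV. of_real (Q $ i) * (u $ i * gradient (face_function Q h) u $ i))
    = of_real D * face_function Q h u"
proof -
  let ?M = "minimal_on Q (box_support h)"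
  have "?M \<noteq> {}"
    using axis_in_box_support[OF h] by (intro minimal_on_nonempty finite_box_support) auto
  then obtain \<kappa> where \<kappa>: "\<kappa> \<in> ?M" by blast
  have D: "weight Q \<nu> = weight Q \<kappa>" if "\<nu> \<in> ?M" for \<nu>
    using that \<kappa> by (auto simp: minimal_on_def intro: antisym)
  have "\<kappa> \<noteq> 0" using \<kappa> h0 by (auto simp: minimal_on_def box_support_def)
  then obtain i where "\<kappa> $ i \<noteq> 0" by (auto simp: vec_eq_iff)
  then have "0 < Q $ i * real (\<kappa> $ i)" using Q by (simp add: strictly_positive_def)
  also have "\<dots> \<le> weight Q \<kappa>" by (rule weight_ge_component[OF Q])
  finally have pos: "0 < weight Q \<kappa>" .
  have "(\<Sum>i\<in>UNIV. of_real (Q $ i) * (u $ i * gradient (face_function Q h) u $ i))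
    = of_real (weight Q \<kappa>) * face_function Q h u" for u
  proof -
    have "(\<Sum>i\<in>UNIV. of_real (Q $ i) * (u $ i * gradient (face_function Q h) u $ i))
        = (\<Sum>i\<in>UNIV. \<Sum>\<nu>\<in>?M. of_real (Q $ i * real (\<nu> $ i)) * (coefficient h \<nu> * monomial_at \<nu> u))"
      unfolding mult_gradient_face_function[OF h Q] sum_distrib_left by (simp add: mult_ac)
    also have "\<dots> = (\<Sum>\<nu>\<in>?M. \<Sum>i\<in>UNIV. of_real (Q $ i * real (\<nu> $ i)) * (coefficient h \<nu> * monomial_at \<nu> u))"
      by (rule sum.swap)
    also have "\<dots> = (\<Sum>\<nu>\<in>?M. of_real (weight Q \<nu>) * (coefficient h \<nu> * monomial_at \<nu> u))"
      unfolding weight_sum of_real_sum sum_distrib_right ..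
    also have "\<dots> = (\<Sum>\<nu>\<in>?M. of_real (weight Q \<kappa>) * (coefficient h \<nu> * monomial_at \<nu> u))"
      by (intro sum.cong refl) (simp add: D)
    finally show ?thesis unfolding face_function_eq[OF h Q] sum_distrib_left .
  qed
  with pos show ?thesis using that by blast
qed

lemma has_field_derivative_prod_powers:
  fixes F :: "'b \<Rightarrow> complex \<Rightarrow> complex"
  assumes "finite A" "\<And>a. a \<in> A \<Longrightarrow> (F a has_field_derivative D a) (at w)" "\<And>a. a \<in> A \<Longrightarrow> F a w \<noteq> 0"
  shows "((\<lambda>w. \<Prod>a\<in>A. F a w ^ m a) has_field_derivative
    (\<Prod>a\<in>A. F a w ^ m a) * (\<Sum>a\<in>A. of_nat (m a) * D a / F a w)) (at w)"
  using assms
proof (induction A rule: finite_induct)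
  case (insert a A)
  let ?R = "\<Prod>a\<in>A. F a w ^ m a" and ?S = "\<Sum>a\<in>A. of_nat (m a) * D a / F a w"
  have IH: "((\<lambda>w. \<Prod>a\<in>A. F a w ^ m a) has_field_derivative ?R * ?S) (at w)"
    using insert by simp
  have Fa: "(F a has_field_derivative D a) (at w)" "F a w \<noteq> 0" using insert.prems by simp_all
  have pow: "((\<lambda>w. F a w ^ m a) has_field_derivative F a w ^ m a * (of_nat (m a) * D a / F a w)) (at w)"
  proof (cases "m a")
    case (Suc p)
    show ?thesis using DERIV_power[OF Fa(1), of "m a"] Fa(2) by (simp add: Suc mult_ac)
  qed simp
  show ?case
    using DERIV_mult[OF pow IH] insert.hyps by (simp add: algebra_simps)
qed simp

section \<open>The logarithmic gradient of a product\<close>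

definition log_gradient :: "(complex ^ 'n \<Rightarrow> complex) \<Rightarrow> complex ^ 'n \<Rightarrow> complex ^ 'n"
  where "log_gradient h z = (\<chi> i. z $ i * gradient h z $ i)"

lemma log_gradient_prod_powers:
  fixes f :: "'b \<Rightarrow> complex ^ 'n \<Rightarrow> complex"
  assumes A: "finite A" and f: "\<And>a. a \<in> A \<Longrightarrow> analytic_at_origin (f a)"
    and g: "g = (\<lambda>z. \<Prod>a\<in>A. f a z ^ m a)"
  shows "\<forall>\<^sub>F z in nhds 0. (\<forall>a\<in>A. f a z \<noteq> 0) \<longrightarrow>
    (\<forall>i. log_gradient g z $ i = g z * (\<Sum>a\<in>A. of_nat (m a) * log_gradient (f a) z $ i / f a z))"
proof -
  have "\<forall>\<^sub>F z in nhds 0. \<forall>i. ((\<lambda>w. f a (replace i z w)) has_field_derivative gradient (f a) z $ i) (at (z $ i))"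
    if "a \<in> A" for a
    by (intro eventually_all_finite has_power_series_differentiable[OF has_power_series_coefficient[OF f[OF that]]])
  then have "\<forall>\<^sub>F z in nhds 0. \<forall>a\<in>A. \<forall>i. ((\<lambda>w. f a (replace i z w)) has_field_derivative gradient (f a) z $ i) (at (z $ i))"
    using A by (simp add: eventually_ball_finite)
  then show ?thesis
  proof (rule eventually_mono, intro impI allI)
    fix z :: "complex^'n" and i
    assume d: "\<forall>a\<in>A. \<forall>i. ((\<lambda>w. f a (replace i z w)) has_field_derivative gradient (f a) z $ i) (at (z $ i))"
      and nz: "\<forall>a\<in>A. f a z \<noteq> 0"
    have "((\<lambda>w. \<Prod>a\<in>A. f a (replace i z w) ^ m a) has_field_derivative
        (\<Prod>a\<in>A. f a (replace i z (z $ i)) ^ m a) *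
        (\<Sum>a\<in>A. of_nat (m a) * gradient (f a) z $ i / f a (replace i z (z $ i)))) (at (z $ i))"
      by (rule has_field_derivative_prod_powers[where F = "\<lambda>a w. f a (replace i z w)", OF A])
        (use d nz in auto)
    then have "gradient g z $ i = g z * (\<Sum>a\<in>A. of_nat (m a) * gradient (f a) z $ i / f a z)"
      unfolding gradient_nth g replace_same by (rule DERIV_imp_deriv)
    then show "log_gradient g z $ i = g z * (\<Sum>a\<in>A. of_nat (m a) * log_gradient (f a) z $ i / f a z)"
      by (simp add: log_gradient_def sum_distrib_left mult_ac)
  qed
qed

text \<open>
  The relation \<open>XF\<close> says that \<open>X\<^sub>\<alpha>\<close> times the value of the face function is the same number \<open>T\<close>
  for all \<open>\<alpha>\<close>, up to the positive factor \<open>m\<^sub>\<alpha>\<close>. Pairing the linear relation \<open>XG\<close> with the weight \<open>Q\<close> and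
  using Euler's identity gives \<open>T\<close> times a positive number equal to zero, hence \<open>T = 0\<close>. So \<open>X\<^sub>\<alpha>\<close> can be nonzero only
  where the face function vanishes, and there linear independence of the gradients applies.
\<close>

lemma no_degenerate_limit:
  fixes f :: "nat \<Rightarrow> complex ^ 'n \<Rightarrow> complex"
  assumes fam: "convenient_nondegenerate_family k f" and f0: "\<And>\<alpha>. \<alpha> \<in> {1..k} \<Longrightarrow> f \<alpha> 0 = 0"
    and m: "\<And>\<alpha>. \<alpha> \<in> {1..k} \<Longrightarrow> m \<alpha> > (0::nat)"
    and Q: "strictly_positive Q" and u: "u \<in> torus"
    and XF: "\<And>\<alpha>. \<alpha> \<in> {1..k} \<Longrightarrow> X \<alpha> * face_function Q (f \<alpha>) u = of_nat (m \<alpha>) * of_real T"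
    and XG: "\<And>i. (\<Sum>\<alpha>=1..k. X \<alpha> * (u $ i * gradient (face_function Q (f \<alpha>)) u $ i)) = 0"
    and \<alpha>: "\<alpha> \<in> {1..k}"
  shows "X \<alpha> = 0"
proof -
  have conv: "convenient (f \<alpha>)" "analytic_at_origin (f \<alpha>)" if "\<alpha> \<in> {1..k}" for \<alpha>
    using fam that by (auto simp: convenient_nondegenerate_family_def)
  have "\<exists>D>0. \<forall>u. (\<Sum>i\<in>UNIV. of_real (Q $ i) * (u $ i * gradient (face_function Q (f \<alpha>)) u $ i))
    = of_real D * face_function Q (f \<alpha>) u" if \<alpha>: "\<alpha> \<in> {1..k}" for \<alpha>
  proof -
    have "0 \<notin> support (f \<alpha>)"
      using has_power_series_at_0[OF has_power_series_coefficient[OF conv(2)[OF \<alpha>]]] f0[OF \<alpha>]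
      by (simp add: support_def)
    from face_function_Euler[OF conv(1)[OF \<alpha>] Q this] show ?thesis by blast
  qed
  then have "\<forall>\<alpha>\<in>{1..k}. \<exists>D. 0 < D \<and> (\<forall>u. (\<Sum>i\<in>UNIV. of_real (Q $ i) * (u $ i * gradient (face_function Q (f \<alpha>)) u $ i))
    = of_real D * face_function Q (f \<alpha>) u)" by blast
  from bchoice[OF this] obtain D where D: "\<And>\<alpha>. \<alpha> \<in> {1..k} \<Longrightarrow> 0 < D \<alpha>"
    "\<And>\<alpha> u. \<alpha> \<in> {1..k} \<Longrightarrow> (\<Sum>i\<in>UNIV. of_real (Q $ i) * (u $ i * gradient (face_function Q (f \<alpha>)) u $ i))
    = of_real (D \<alpha>) * face_function Q (f \<alpha>) u"
    by blast
  have "of_real (T * (\<Sum>\<alpha>=1..k. m \<alpha> * D \<alpha>)) = (\<Sum>\<alpha>=1..k. of_real (D \<alpha>) * (X \<alpha> * face_function Q (f \<alpha>) u))"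
    unfolding of_real_mult of_real_sum sum_distrib_left
    by (intro sum.cong refl) (simp add: XF)
  also have "\<dots> = (\<Sum>\<alpha>=1..k. \<Sum>i\<in>UNIV. of_real (Q $ i) * (X \<alpha> * (u $ i * gradient (face_function Q (f \<alpha>)) u $ i)))"
  proof (intro sum.cong refl)
    fix \<alpha> assume "\<alpha> \<in> {1..k}"
    from arg_cong[OF D(2)[OF this, of u], of "\<lambda>x. X \<alpha> * x"]
    show "of_real (D \<alpha>) * (X \<alpha> * face_function Q (f \<alpha>) u)
      = (\<Sum>i\<in>UNIV. of_real (Q $ i) * (X \<alpha> * (u $ i * gradient (face_function Q (f \<alpha>)) u $ i)))"
      by (simp add: sum_distrib_left mult_ac)
  qed
  also have "\<dots> = (\<Sum>i\<in>UNIV. of_real (Q $ i) * (\<Sum>\<alpha>=1..k. X \<alpha> * (u $ i * gradient (face_function Q (f \<alpha>)) u $ i)))"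
    unfolding sum_distrib_left by (rule sum.swap)
  also have "\<dots> = 0" unfolding XG by simp
  finally have "T * (\<Sum>\<alpha>=1..k. m \<alpha> * D \<alpha>) = 0" by (simp only: of_real_eq_0_iff)
  moreover have "0 < (\<Sum>\<alpha>=1..k. m \<alpha> * D \<alpha>)"
    using D(1) m \<alpha> by (intro sum_pos) auto
  ultimately have T0: "T = 0" by simp
  define I where "I = {\<alpha>\<in>{1..k}. face_function Q (f \<alpha>) u = 0}"
  have outside: "X \<alpha> = 0" if "\<alpha> \<in> {1..k}" "\<alpha> \<notin> I" for \<alpha>
    using XF[OF that(1)] that by (simp add: T0 I_def)
  have "(\<Sum>\<alpha>\<in>I. X \<alpha> *s gradient (face_function Q (f \<alpha>)) u) = 0"
  proof (subst vec_eq_iff, rule allI)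
    fix i
    have "u $ i * (\<Sum>\<alpha>\<in>I. X \<alpha> *s gradient (face_function Q (f \<alpha>)) u) $ i
        = (\<Sum>\<alpha>\<in>I. X \<alpha> * (u $ i * gradient (face_function Q (f \<alpha>)) u $ i))"
      by (simp add: sum_component sum_distrib_left mult_ac)
    also have "\<dots> = (\<Sum>\<alpha>=1..k. X \<alpha> * (u $ i * gradient (face_function Q (f \<alpha>)) u $ i))"
    proof (rule sum.mono_neutral_left)
      show "I \<subseteq> {1..k}" by (auto simp: I_def)
      show "\<forall>\<alpha>\<in>{1..k} - I. X \<alpha> * (u $ i * gradient (face_function Q (f \<alpha>)) u $ i) = 0"
      proof
        fix \<alpha> assume "\<alpha> \<in> {1..k} - I"
        then have "X \<alpha> = 0" by (intro outside) auto
        then show "X \<alpha> * (u $ i * gradient (face_function Q (f \<alpha>)) u $ i) = 0" by simp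
      qed
    qed simp
    finally show "(\<Sum>\<alpha>\<in>I. X \<alpha> *s gradient (face_function Q (f \<alpha>)) u) $ i = 0 $ i"
      unfolding XG using u by (simp add: torus_def)
  qed
  moreover have "nondegenerate_complete_intersection I f"
  proof -
    have "I \<subseteq> {1..k}" by (auto simp: I_def)
    then show ?thesis using fam unfolding convenient_nondegenerate_family_def by blast
  qed
  ultimately have "\<forall>\<alpha>\<in>I. X \<alpha> = 0"
    using Q u unfolding nondegenerate_complete_intersection_def by (simp add: I_def)
  then show ?thesis using outside \<alpha> by blast
qed

text \<open>
  The key inequality. The coefficients \<open>y\<^sub>\<alpha> = m\<^sub>\<alpha> / F\<^sub>\<alpha>\<close> of the relation for \<open>L g / g\<close> may be unbounded; divided
  by their total size \<open>V\<close> they stay in the unit disc and keep total size \<open>1\<close>. Since \<open>1 / V\<close> is bounded by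
  \<open>|F\<^sub>\<beta>|\<close>, both quantities converge along a further subsequence, and the violated inequality is exactly
  what makes the normalised linear relation hold in the limit.
\<close>

lemma log_gradient_lower_bound:
  fixes f :: "nat \<Rightarrow> complex ^ 'n \<Rightarrow> complex"
  assumes fam: "convenient_nondegenerate_family k f" and f0: "\<And>\<alpha>. \<alpha> \<in> {1..k} \<Longrightarrow> f \<alpha> 0 = 0"
    and m: "\<And>\<alpha>. \<alpha> \<in> {1..k} \<Longrightarrow> m \<alpha> > 0" and g: "g = (\<lambda>z. \<Prod>\<alpha>=1..k. f \<alpha> z ^ m \<alpha>)"
    and \<beta>: "\<beta> \<in> {1..k}"
  shows "\<exists>c>0. \<forall>\<^sub>F z in nhds 0. z \<in> torus \<longrightarrow>
    c * norm (g z) * box_size (f \<beta>) z \<le> norm (log_gradient g z) * norm (f \<beta> z)"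
proof (rule ccontr)
  assume contra: "\<not> ?thesis"
  have conv: "convenient (f \<alpha>)" "analytic_at_origin (f \<alpha>)" if "\<alpha> \<in> {1..k}" for \<alpha>
    using fam that by (auto simp: convenient_nondegenerate_family_def)
  obtain e where e: "0 < e" and formula: "\<And>z. norm z < e \<Longrightarrow> (\<forall>a\<in>{1..k}. f a z \<noteq> 0) \<Longrightarrow>
    (\<forall>i. log_gradient g z $ i = g z * (\<Sum>a\<in>{1..k}. of_nat (m a) * log_gradient (f a) z $ i / f a z))"
    using log_gradient_prod_powers[of "{1..k}" f g m, OF _ conv(2) g]
    unfolding eventually_nhds_metric by (auto simp: dist_norm)
  have "\<exists>z. z \<in> torus \<and> norm z < min e (1 / real (Suc n)) \<and>
      norm (log_gradient g z) * norm (f \<beta> z) < 1 / real (Suc n) * norm (g z) * box_size (f \<beta>) z" for n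
  proof (rule ccontr)
    assume none: "\<not> ?thesis"
    have "\<forall>\<^sub>F z in nhds (0::complex^'n). norm z < min e (1 / real (Suc n))"
      using e by (auto simp: eventually_nhds_metric dist_norm intro!: exI[of _ "min e (1 / real (Suc n))"])
    then have "\<forall>\<^sub>F z in nhds 0. z \<in> torus \<longrightarrow>
        1 / real (Suc n) * norm (g z) * box_size (f \<beta>) z \<le> norm (log_gradient g z) * norm (f \<beta> z)"
      by (rule eventually_mono) (use none not_le in blast)
    moreover have "0 < 1 / real (Suc n)" by simp
    ultimately show False using contra by blast
  qed
  then obtain z where tor: "\<And>n. z n \<in> torus" and z_small: "\<And>n. norm (z n) < min e (1 / real (Suc n))"
    and viol: "\<And>n. norm (log_gradient g (z n)) * norm (f \<beta> (z n))
      < 1 / real (Suc n) * norm (g (z n)) * box_size (f \<beta>) (z n)"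
    by metis
  have inv0: "(\<lambda>n. 1 / real (Suc n)) \<longlonglongrightarrow> 0" using LIMSEQ_inverse_real_of_nat by (simp add: inverse_eq_divide)
  have z0: "z \<longlonglongrightarrow> 0"
    by (rule Lim_null_comparison[OF always_eventually inv0]) (use z_small in \<open>auto intro: less_imp_le\<close>)
  have g_nz: "g (z n) \<noteq> 0" for n
  proof
    assume "g (z n) = 0"
    then have "norm (log_gradient g (z n)) * norm (f \<beta> (z n)) < 0" using viol[of n] by simp
    moreover have "0 \<le> norm (log_gradient g (z n)) * norm (f \<beta> (z n))" by simp
    ultimately show False by linarith
  qed
  have f_nz: "f \<alpha> (z n) \<noteq> 0" if "\<alpha> \<in> {1..k}" for \<alpha> n
    using g_nz[of n] m[OF that] that by (auto simp: g)
  have L: "log_gradient g (z n) $ i / g (z n) = (\<Sum>a=1..k. of_nat (m a) * log_gradient (f a) (z n) $ i / f a (z n))"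
    for n i
  proof -
    have "log_gradient g (z n) $ i = g (z n) * (\<Sum>a=1..k. of_nat (m a) * log_gradient (f a) (z n) $ i / f a (z n))"
      using formula[of "z n"] z_small[of n] f_nz by simp
    then show ?thesis using g_nz[of n] by simp
  qed
  (* The violating sequence lies where g, hence every factor, is nonzero, and degenerates to a point u of the
     torus with respect to a weight Q. *)
  obtain r Q u d where r: "strict_mono r" and Q: "strictly_positive Q" and u: "u \<in> torus"
    and lim: "\<And>\<alpha> \<nu>. \<alpha> \<in> {1..k} \<Longrightarrow> \<nu> \<in> box_support (f \<alpha>) \<Longrightarrow>
      (\<lambda>n. of_real (exp (d \<alpha> n)) * monomial_at \<nu> (z (r n)))
       \<longlonglongrightarrow> (if \<nu> \<in> minimal_on Q (box_support (f \<alpha>)) then monomial_at \<nu> u else 0)"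
  proof (rule toric_limit[where z = z and A = "{1..k}" and K = "\<lambda>\<alpha>. box_support (f \<alpha>)"])
    show "box_support (f \<alpha>) \<noteq> {}" if "\<alpha> \<in> {1..k}" for \<alpha>
      using axis_in_box_support[OF conv(1)[OF that]] by blast
  qed (use tor z0 finite_box_support in auto)
  define E where "E \<alpha> n = exp (d \<alpha> n)" for \<alpha> n
  have E: "0 < E \<alpha> n" for \<alpha> n by (simp add: E_def)
  have zr0: "(\<lambda>n. z (r n)) \<longlonglongrightarrow> 0" using LIMSEQ_subseq_LIMSEQ[OF z0 r] by (simp add: o_def)
  define F where "F \<alpha> n = of_real (E \<alpha> n) * f \<alpha> (z (r n))" for \<alpha> n
  define G where "G \<alpha> i n = of_real (E \<alpha> n) * log_gradient (f \<alpha>) (z (r n)) $ i" for \<alpha> i n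
  have F: "F \<alpha> \<longlonglongrightarrow> face_function Q (f \<alpha>) u" if \<alpha>: "\<alpha> \<in> {1..k}" for \<alpha>
    unfolding F_def E_def
    by (rule initial_form_limit_face(1)[OF conv(2)[OF \<alpha>] conv(1)[OF \<alpha>] Q zr0 _ lim[OF \<alpha>]]) auto
  have G: "G \<alpha> i \<longlonglongrightarrow> u $ i * gradient (face_function Q (f \<alpha>)) u $ i" if \<alpha>: "\<alpha> \<in> {1..k}" for \<alpha> i
    unfolding G_def E_def log_gradient_def vec_lambda_beta
    by (rule initial_form_limit_face(2)[OF conv(2)[OF \<alpha>] conv(1)[OF \<alpha>] Q zr0 _ lim[OF \<alpha>]]) auto
  have F_nz: "F \<alpha> n \<noteq> 0" if "\<alpha> \<in> {1..k}" for \<alpha> n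
    using f_nz[OF that] E[of \<alpha> n] by (simp add: F_def)
  have "(\<lambda>n. \<Sum>\<nu>\<in>box_support (f \<beta>). norm (of_real (exp (d \<beta> n)) * monomial_at \<nu> (z (r n)))) \<longlonglongrightarrow>
      (\<Sum>\<nu>\<in>box_support (f \<beta>). norm (if \<nu> \<in> minimal_on Q (box_support (f \<beta>)) then monomial_at \<nu> u else 0))"
    (is "_ \<longlonglongrightarrow> ?N") by (intro tendsto_sum tendsto_norm lim \<beta>)
  then have box_lim: "(\<lambda>n. E \<beta> n * box_size (f \<beta>) (z (r n))) \<longlonglongrightarrow> ?N"
    by (simp add: norm_mult box_size_def sum_distrib_left E_def)
  define y where "y \<alpha> n = of_nat (m \<alpha>) / F \<alpha> n" for \<alpha> n
  have y_nz: "y \<alpha> n \<noteq> 0" if "\<alpha> \<in> {1..k}" for \<alpha> n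
    using F_nz[OF that] m[OF that] by (simp add: y_def)
  define V where "V n = (\<Sum>\<alpha>=1..k. norm (y \<alpha> n))" for n
  have y_le: "norm (y \<alpha> n) \<le> V n" if "\<alpha> \<in> {1..k}" for \<alpha> n
    unfolding V_def by (rule member_le_sum) (use that in auto)
  have V: "0 < V n" for n using y_le[OF \<beta>, of n] y_nz[OF \<beta>, of n] by (smt (verit) zero_less_norm_iff)
  define x where "x \<alpha> n = y \<alpha> n / of_real (V n)" for \<alpha> n
  have V_inv: "1 / V n \<le> norm (F \<beta> n)" for n
  proof -
    have "1 / V n \<le> 1 / norm (y \<beta> n)"
      using y_le[OF \<beta>, of n] y_nz[OF \<beta>, of n] V[of n] by (intro divide_left_mono) auto
    also have "\<dots> = norm (F \<beta> n) / real (m \<beta>)" by (simp add: y_def norm_divide)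
    also have "\<dots> \<le> norm (F \<beta> n) / 1" using m[OF \<beta>] by (intro divide_left_mono) auto
    finally show ?thesis by simp
  qed
  obtain B where B: "\<And>n. norm (F \<beta> n) \<le> B"
    using F[OF \<beta>, THEN convergent_imp_bounded] unfolding bounded_iff by auto
  (* Index 0 carries the sequence 1 / V, so that a single extraction serves all limits. *)
  define s where "s = (\<lambda>\<alpha> n. if \<alpha> = 0 then of_real (1 / V n) else x \<alpha> n)"
  have "bounded (range (s \<alpha>))" if \<alpha>: "\<alpha> \<in> {0..k}" for \<alpha>
  proof (cases "\<alpha> = 0")
    case True
    have "norm (s \<alpha> n) \<le> B" for n
      using V_inv[of n] B[of n] V[of n] True by (simp add: s_def norm_divide)
    then show ?thesis unfolding bounded_iff by blast
  next
    case False
    have "norm (s \<alpha> n) \<le> 1" for n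
      using y_le[of \<alpha> n] V[of n] \<alpha> False by (simp add: s_def x_def norm_divide)
    then show ?thesis unfolding bounded_iff by blast
  qed
  then obtain q X where q: "strict_mono q" and X: "\<And>\<alpha>. \<alpha> \<in> {0..k} \<Longrightarrow> (\<lambda>n. s \<alpha> (q n)) \<longlonglongrightarrow> X \<alpha>"
    using bounded_family_subsequence[of "{0..k}" s] by (meson finite_atLeastAtMost)
  have X0: "(\<lambda>n. of_real (1 / V (q n))) \<longlonglongrightarrow> X 0" using X[of 0] by (simp add: s_def)
  have Xx: "(\<lambda>n. x \<alpha> (q n)) \<longlonglongrightarrow> X \<alpha>" if "\<alpha> \<in> {1..k}" for \<alpha>
    using X[of \<alpha>] that by (simp add: s_def)
  define T where "T = Re (X 0)"
  have Tlim: "(\<lambda>n. 1 / V (q n)) \<longlonglongrightarrow> T"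
    using tendsto_Re[OF X0] by (simp add: T_def)
  have X0T: "X 0 = of_real T"
    using LIMSEQ_unique[OF X0 tendsto_of_real[OF Tlim]] .
  have Fq: "(\<lambda>n. F \<alpha> (q n)) \<longlonglongrightarrow> face_function Q (f \<alpha>) u" if "\<alpha> \<in> {1..k}" for \<alpha>
    using LIMSEQ_subseq_LIMSEQ[OF F[OF that] q] by (simp add: o_def)
  have Gq: "(\<lambda>n. G \<alpha> i (q n)) \<longlonglongrightarrow> u $ i * gradient (face_function Q (f \<alpha>)) u $ i" if "\<alpha> \<in> {1..k}" for \<alpha> i
    using LIMSEQ_subseq_LIMSEQ[OF G[OF that] q] by (simp add: o_def)
  have XF: "X \<alpha> * face_function Q (f \<alpha>) u = of_nat (m \<alpha>) * of_real T" if \<alpha>: "\<alpha> \<in> {1..k}" for \<alpha>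
  proof (rule LIMSEQ_unique)
    show "(\<lambda>n. x \<alpha> (q n) * F \<alpha> (q n)) \<longlonglongrightarrow> X \<alpha> * face_function Q (f \<alpha>) u"
      by (intro tendsto_mult Xx Fq \<alpha>)
    have "x \<alpha> n * F \<alpha> n = of_nat (m \<alpha>) * of_real (1 / V n)" for n
      using F_nz[OF \<alpha>, of n] by (simp add: x_def y_def)
    then show "(\<lambda>n. x \<alpha> (q n) * F \<alpha> (q n)) \<longlonglongrightarrow> of_nat (m \<alpha>) * of_real T"
      using tendsto_mult[OF tendsto_const[of "of_nat (m \<alpha>)"] X0] by (simp add: X0T)
  qed
  have XG: "(\<Sum>\<alpha>=1..k. X \<alpha> * (u $ i * gradient (face_function Q (f \<alpha>)) u $ i)) = 0" for i
  proof (rule LIMSEQ_unique)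
    show "(\<lambda>n. \<Sum>\<alpha>=1..k. x \<alpha> (q n) * G \<alpha> i (q n)) \<longlonglongrightarrow>
        (\<Sum>\<alpha>=1..k. X \<alpha> * (u $ i * gradient (face_function Q (f \<alpha>)) u $ i))"
      by (intro tendsto_sum tendsto_mult Xx Gq)
    (* This sum is the i-th component of L g / (V g), to which the violated inequality applies. *)
    have "norm (\<Sum>\<alpha>=1..k. x \<alpha> n * G \<alpha> i n)
        \<le> 1 / real (Suc (r n)) * (E \<beta> n * box_size (f \<beta>) (z (r n)))" for n
    proof -
      let ?z = "z (r n)"
      have "x \<alpha> n * G \<alpha> i n = of_real (1 / V n) * (of_nat (m \<alpha>) * log_gradient (f \<alpha>) ?z $ i / f \<alpha> ?z)" for \<alpha>
        using E[of \<alpha> n] by (simp add: x_def y_def F_def G_def)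
      then have "(\<Sum>\<alpha>=1..k. x \<alpha> n * G \<alpha> i n) = of_real (1 / V n) * (log_gradient g ?z $ i / g ?z)"
        by (simp only: L sum_distrib_left)
      then have "norm (\<Sum>\<alpha>=1..k. x \<alpha> n * G \<alpha> i n) = 1 / V n * (norm (log_gradient g ?z $ i) / norm (g ?z))"
        using V[of n] by (simp add: norm_mult norm_divide)
      also have "\<dots> \<le> norm (F \<beta> n) * (norm (log_gradient g ?z) / norm (g ?z))"
      proof (rule mult_mono)
        show "1 / V n \<le> norm (F \<beta> n)" by (rule V_inv)
        show "norm (log_gradient g ?z $ i) / norm (g ?z) \<le> norm (log_gradient g ?z) / norm (g ?z)"
          by (intro divide_right_mono Finite_Cartesian_Product.norm_nth_le) simp
      qed auto
      also have "\<dots> = E \<beta> n * (norm (log_gradient g ?z) * norm (f \<beta> ?z)) / norm (g ?z)"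
        using E[of \<beta> n] by (simp add: F_def norm_mult)
      also have "\<dots> \<le> E \<beta> n * (1 / real (Suc (r n)) * norm (g ?z) * box_size (f \<beta>) ?z) / norm (g ?z)"
        using viol[of "r n"] E[of \<beta> n] by (intro divide_right_mono mult_left_mono) auto
      also have "\<dots> = 1 / real (Suc (r n)) * (E \<beta> n * box_size (f \<beta>) ?z)"
        using g_nz[of "r n"] by simp
      finally show ?thesis .
    qed
    then have le: "\<forall>n. norm (\<Sum>\<alpha>=1..k. x \<alpha> n * G \<alpha> i n)
        \<le> 1 / real (Suc (r n)) * (E \<beta> n * box_size (f \<beta>) (z (r n)))" by blast
    have "(\<lambda>n. 1 / real (Suc (r n)) * (E \<beta> n * box_size (f \<beta>) (z (r n)))) \<longlonglongrightarrow> 0 * ?N"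
      using LIMSEQ_subseq_LIMSEQ[OF inv0 r] by (intro tendsto_mult box_lim) (simp add: o_def)
    then have "(\<lambda>n. 1 / real (Suc (r n)) * (E \<beta> n * box_size (f \<beta>) (z (r n)))) \<longlonglongrightarrow> 0"
      by (simp only: mult_zero_left)
    then have "(\<lambda>n. \<Sum>\<alpha>=1..k. x \<alpha> n * G \<alpha> i n) \<longlonglongrightarrow> 0"
      by (rule Lim_null_comparison[OF always_eventually[OF le]])
    then show "(\<lambda>n. \<Sum>\<alpha>=1..k. x \<alpha> (q n) * G \<alpha> i (q n)) \<longlonglongrightarrow> 0"
      using LIMSEQ_subseq_LIMSEQ[OF _ q, of "\<lambda>n. \<Sum>\<alpha>=1..k. x \<alpha> n * G \<alpha> i n" 0] by (simp add: o_def)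
  qed
  have Xzero: "X \<alpha> = 0" if "\<alpha> \<in> {1..k}" for \<alpha>
    using no_degenerate_limit[OF fam f0 m Q u XF XG that] by blast
  have "(\<Sum>\<alpha>=1..k. norm (X \<alpha>)) = 1"
  proof (rule LIMSEQ_unique)
    show "(\<lambda>n. \<Sum>\<alpha>=1..k. norm (x \<alpha> (q n))) \<longlonglongrightarrow> (\<Sum>\<alpha>=1..k. norm (X \<alpha>))"
      by (intro tendsto_sum tendsto_norm Xx)
    have "(\<Sum>\<alpha>=1..k. norm (x \<alpha> n)) = 1" for n
    proof -
      have "(\<Sum>\<alpha>=1..k. norm (x \<alpha> n)) = V n / V n"
        using V[of n] unfolding x_def norm_divide
        by (simp only: norm_of_real abs_of_pos flip: sum_divide_distrib V_def)
      then show ?thesis using V[of n] by simp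
    qed
    then show "(\<lambda>n. \<Sum>\<alpha>=1..k. norm (x \<alpha> (q n))) \<longlonglongrightarrow> 1" by simp
  qed
  then show False using Xzero by simp
qed

section \<open>Products of analytic germs\<close>

lemma has_sum_product_complex:
  fixes F :: "'a \<Rightarrow> complex" and G :: "'b \<Rightarrow> complex"
  assumes F: "(F has_sum s) UNIV" and G: "(G has_sum t) UNIV"
  shows "((\<lambda>p. F (fst p) * G (snd p)) has_sum s * t) (UNIV \<times> UNIV)"
proof (rule has_sum_SigmaI)
  show "((\<lambda>y. F (fst (x, y)) * G (snd (x, y))) has_sum F x * t) UNIV" for x
    using has_sum_cmult_right[OF G] by simp
  show "((\<lambda>x. F x * t) has_sum s * t) UNIV" by (rule has_sum_cmult_left[OF F])
  have nF: "(\<lambda>x. norm (F x)) summable_on UNIV" and nG: "(\<lambda>y. norm (G y)) summable_on UNIV"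
    using F G has_sum_imp_summable summable_on_iff_abs_summable_on_complex by blast+
  have "(\<lambda>p. norm (F (fst p)) * norm (G (snd p))) summable_on (UNIV \<times> UNIV)"
  proof (rule summable_on_SigmaI)
    show "((\<lambda>y. norm (F (fst (x, y))) * norm (G (snd (x, y)))) has_sum
        norm (F x) * infsum (\<lambda>y. norm (G y)) UNIV) UNIV" for x
      using has_sum_cmult_right[OF has_sum_infsum[OF nG]] by simp
    show "(\<lambda>x. norm (F x) * infsum (\<lambda>y. norm (G y)) UNIV) summable_on UNIV"
      by (rule summable_on_cmult_left[OF nF])
  qed simp
  then have "(\<lambda>p. norm (F (fst p) * G (snd p))) summable_on (UNIV \<times> UNIV)"
    by (simp only: norm_mult)
  then show "(\<lambda>p. F (fst p) * G (snd p)) summable_on (UNIV \<times> UNIV)" by (rule abs_summable_summable)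
qed

text \<open>
  The Cauchy product: regroup the absolutely convergent double series by the sum of the two indices; each group
  is finite.
\<close>

lemma has_power_series_mult:
  fixes h h' :: "complex ^ 'n \<Rightarrow> complex"
  assumes h: "has_power_series h c" and h': "has_power_series h' c'"
  shows "has_power_series (\<lambda>z. h z * h' z) (\<lambda>\<nu>. \<Sum>p\<in>{p. fst p + snd p = \<nu>}. c (fst p) * c' (snd p))"
  unfolding has_power_series_def
proof (rule eventually_mono[OF eventually_conj[OF h[unfolded has_power_series_def] h'[unfolded has_power_series_def]]])
  fix z :: "complex ^ 'n"
  assume "((\<lambda>\<nu>. c \<nu> * monomial_at \<nu> z) has_sum h z) UNIV \<and> ((\<lambda>\<nu>. c' \<nu> * monomial_at \<nu> z) has_sum h' z) UNIV"
  then have "((\<lambda>p. c (fst p) * monomial_at (fst p) z * (c' (snd p) * monomial_at (snd p) z)) has_sum h z * h' z) (UNIV \<times> UNIV)"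
    by (intro has_sum_product_complex) auto
  moreover have "c (fst p) * monomial_at (fst p) z * (c' (snd p) * monomial_at (snd p) z)
      = c (fst p) * c' (snd p) * monomial_at (fst p + snd p) z" for p
    by (simp add: monomial_at_add mult_ac)
  ultimately have "((\<lambda>p. c (fst p) * c' (snd p) * monomial_at (fst p + snd p) z) has_sum h z * h' z) (UNIV \<times> UNIV)"
    by simp
  also have "?this \<longleftrightarrow> ((\<lambda>q. c (fst (snd q)) * c' (snd (snd q)) * monomial_at (fst q) z) has_sum h z * h' z)
      (SIGMA \<nu>:UNIV. {p. fst p + snd p = \<nu>})"
    by (rule has_sum_reindex_bij_witness[where j = "\<lambda>p. (fst p + snd p, p)" and i = snd]) auto
  finally have "((\<lambda>q. c (fst (snd q)) * c' (snd (snd q)) * monomial_at (fst q) z) has_sum h z * h' z)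
      (SIGMA \<nu>:UNIV. {p. fst p + snd p = \<nu>})" .
  then show "((\<lambda>\<nu>. (\<Sum>p\<in>{p. fst p + snd p = \<nu>}. c (fst p) * c' (snd p)) * monomial_at \<nu> z) has_sum h z * h' z) UNIV"
  proof (rule has_sum_SigmaD)
    fix \<nu> :: "nat ^ 'n"
    have "finite {p :: (nat ^ 'n) \<times> (nat ^ 'n). fst p + snd p = \<nu>}"
    proof (rule finite_subset)
      show "{p :: (nat ^ 'n) \<times> (nat ^ 'n). fst p + snd p = \<nu>}
          \<subseteq> {\<mu>. \<forall>i. \<mu> $ i \<le> \<nu> $ i} \<times> {\<mu>. \<forall>i. \<mu> $ i \<le> \<nu> $ i}"
        by auto
    qed (intro finite_cartesian_product finite_bounded_exponents)
    then show "((\<lambda>p. c (fst (snd (\<nu>, p))) * c' (snd (snd (\<nu>, p))) * monomial_at (fst (\<nu>, p)) z) has_sum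
        (\<Sum>p\<in>{p. fst p + snd p = \<nu>}. c (fst p) * c' (snd p)) * monomial_at \<nu> z) {p. fst p + snd p = \<nu>}"
      by (intro has_sum_finiteI) (auto simp: sum_distrib_right)
  qed
qed

lemma analytic_at_origin_mult:
  "analytic_at_origin h \<Longrightarrow> analytic_at_origin h' \<Longrightarrow> analytic_at_origin (\<lambda>z. h z * h' z)"
  unfolding analytic_at_origin_def using has_power_series_mult by blast

lemma analytic_at_origin_one: "analytic_at_origin (\<lambda>z. 1)"
proof -
  have "has_power_series (\<lambda>z::complex^'n. 1) (\<lambda>\<nu>. if \<nu> = 0 then 1 else 0)"
    unfolding has_power_series_def
    by (intro always_eventually allI has_sum_finite_neutralI[where B = "{0}"]) (auto simp: monomial_at_def)
  then show ?thesis unfolding analytic_at_origin_def by blast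
qed

lemma analytic_at_origin_power: "analytic_at_origin h \<Longrightarrow> analytic_at_origin (\<lambda>z. h z ^ n)"
  by (induction n) (simp_all add: analytic_at_origin_one analytic_at_origin_mult)

lemma analytic_at_origin_prod:
  assumes "finite A" "\<And>a. a \<in> A \<Longrightarrow> analytic_at_origin (h a)"
  shows "analytic_at_origin (\<lambda>z. \<Prod>a\<in>A. h a z)"
  using assms by (induction A rule: finite_induct) (simp_all add: analytic_at_origin_one analytic_at_origin_mult)

section \<open>The gradient inequality near the origin\<close>

lemma bounded_by_box_size:
  fixes h :: "complex ^ 'n \<Rightarrow> complex"
  assumes an: "analytic_at_origin h" and h: "convenient h"
  shows "\<exists>C. \<forall>\<^sub>F z in nhds 0. norm (h z) \<le> C * box_size h z"
proof -
  let ?K = "box_support h"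
  obtain C where C: "\<forall>\<^sub>F z in nhds 0. norm (h z - (\<Sum>\<nu>\<in>?K. coefficient h \<nu> * monomial_at \<nu> z)) \<le> C * norm z * box_size h z"
    using box_tail_bound[OF h has_power_series_coefficient[OF an]] by (auto simp: support_def)
  have "\<forall>\<^sub>F z in nhds (0::complex^'n). norm z < 1"
    by (auto simp: eventually_nhds_metric dist_norm intro!: exI[of _ 1])
  with C have "\<forall>\<^sub>F z in nhds 0. norm (h z) \<le> (\<bar>C\<bar> + (\<Sum>\<nu>\<in>?K. norm (coefficient h \<nu>))) * box_size h z"
  proof eventually_elim
    case (elim z)
    have "norm (h z) \<le> norm (h z - (\<Sum>\<nu>\<in>?K. coefficient h \<nu> * monomial_at \<nu> z)) + norm (\<Sum>\<nu>\<in>?K. coefficient h \<nu> * monomial_at \<nu> z)"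
      using norm_triangle_sub[of "h z" "\<Sum>\<nu>\<in>?K. coefficient h \<nu> * monomial_at \<nu> z"] by simp
    also have "norm (\<Sum>\<nu>\<in>?K. coefficient h \<nu> * monomial_at \<nu> z) \<le> (\<Sum>\<nu>\<in>?K. norm (coefficient h \<nu>) * box_size h z)"
      by (intro sum_norm_le) (simp add: norm_mult mult_left_mono monomial_le_box_size)
    also have "C * norm z * box_size h z \<le> \<bar>C\<bar> * 1 * box_size h z"
      using elim(2) box_size_nonneg[of h z] by (intro mult_right_mono mult_mono) auto
    then have "norm (h z - (\<Sum>\<nu>\<in>?K. coefficient h \<nu> * monomial_at \<nu> z)) \<le> \<bar>C\<bar> * box_size h z"
      using elim(1) by simp
    finally show ?case by (simp add: distrib_right sum_distrib_right)
  qed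
  then show ?thesis by blast
qed

lemma box_size_pos:
  assumes h: "convenient h" and z: "z \<in> torus" shows "0 < box_size h z"
proof -
  obtain \<nu> where \<nu>: "\<nu> \<in> box_support h" using axis_in_box_support[OF h] by blast
  have "monomial_at \<nu> z \<noteq> 0" using z by (simp add: monomial_at_def torus_def)
  then show ?thesis using monomial_le_box_size[OF \<nu>, of z] by (smt (verit) zero_less_norm_iff)
qed

lemma axis_power_le_box_size:
  assumes h: "convenient h" shows "norm (z $ i) ^ axis_exponent h i \<le> box_size h z"
  using monomial_le_box_size[OF axis_in_box_support[OF h, of i], of z] by (simp add: monomial_at_axis norm_power)

lemma axis_exponent_pos:
  fixes h :: "complex ^ 'n \<Rightarrow> complex"
  assumes "convenient h" "analytic_at_origin h" "h 0 = 0" shows "1 \<le> axis_exponent h j"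
proof (rule ccontr)
  assume "\<not> 1 \<le> axis_exponent h j"
  then have "axis j (axis_exponent h j) = (0 :: nat ^ 'n)" by (simp add: vec_eq_iff axis_def)
  then have "0 \<in> support h" using convenient_support[OF assms(1), of j] by (simp only:)
  then show False
    using has_power_series_at_0[OF has_power_series_coefficient[OF assms(2)]] assms(3) by (simp add: support_def)
qed

text \<open>
  The comparison of exponents described at the beginning. The constant \<open>C1\<close> bounds the ratios
  \<open>|f\<^sub>\<alpha>| / M\<^sub>\<alpha>\<close>, so that powers of \<open>\<epsilon>\<close> may be lowered at the price of powers of \<open>C1\<close>.
\<close>

lemma gradient_bound_on_torus:
  fixes f :: "nat \<Rightarrow> complex ^ 'n \<Rightarrow> complex"
  assumes k: "k \<ge> 1" and fam: "convenient_nondegenerate_family k f"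
    and f0: "\<And>\<alpha>. \<alpha> \<in> {1..k} \<Longrightarrow> f \<alpha> 0 = 0"
    and m: "\<And>\<alpha>. \<alpha> \<in> {1..k} \<Longrightarrow> m \<alpha> > 0" and g: "g = (\<lambda>z. \<Prod>\<alpha>=1..k. f \<alpha> z ^ m \<alpha>)"
    and b: "\<And>j. (\<Sum>\<alpha>=1..k. m \<alpha> * axis_exponent (f \<alpha>) j) \<le> b"
  shows "\<exists>c>0. \<forall>\<^sub>F z in nhds 0. z \<in> torus \<longrightarrow>
    c * norm (g z) powr (1 - 1 / real b) \<le> norm (gradient g z)"
proof -
  have conv: "convenient (f \<alpha>)" "analytic_at_origin (f \<alpha>)" if "\<alpha> \<in> {1..k}" for \<alpha>
    using fam that by (auto simp: convenient_nondegenerate_family_def)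
  define S where "S = (\<Sum>\<alpha>=1..k. m \<alpha>)"
  have S_le: "S \<le> (\<Sum>\<alpha>=1..k. m \<alpha> * axis_exponent (f \<alpha>) j)" for j
    unfolding S_def
  proof (rule sum_mono)
    fix \<alpha> assume \<alpha>: "\<alpha> \<in> {1..k}"
    show "m \<alpha> \<le> m \<alpha> * axis_exponent (f \<alpha>) j"
      using axis_exponent_pos[OF conv[OF \<alpha>] f0[OF \<alpha>], of j] by simp
  qed
  have "0 < S" unfolding S_def using k m by (intro sum_pos) auto
  have Sb: "S \<le> b" using S_le b order_trans by blast
  have b0: "0 < b" using \<open>0 < S\<close> Sb by simp
  have "\<forall>\<beta>\<in>{1..k}. \<exists>c. 0 < c \<and> (\<forall>\<^sub>F z in nhds 0. z \<in> torus \<longrightarrow>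
      c * norm (g z) * box_size (f \<beta>) z \<le> norm (log_gradient g z) * norm (f \<beta> z))"
    using log_gradient_lower_bound[OF fam f0 m g] by blast
  from bchoice[OF this] obtain c where c: "\<And>\<beta>. \<beta> \<in> {1..k} \<Longrightarrow> 0 < c \<beta>"
    "\<And>\<beta>. \<beta> \<in> {1..k} \<Longrightarrow> \<forall>\<^sub>F z in nhds 0. z \<in> torus \<longrightarrow>
      c \<beta> * norm (g z) * box_size (f \<beta>) z \<le> norm (log_gradient g z) * norm (f \<beta> z)"
    by blast
  define c0 where "c0 = Min (c ` {1..k})"
  have c0: "0 < c0" using c(1) k by (auto simp: c0_def Min_gr_iff)
  have c0_le: "c0 \<le> c \<beta>" if "\<beta> \<in> {1..k}" for \<beta> using that by (simp add: c0_def)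
  have "\<forall>\<beta>\<in>{1..k}. \<exists>C. \<forall>\<^sub>F z in nhds 0. norm (f \<beta> z) \<le> C * box_size (f \<beta>) z"
    using bounded_by_box_size conv by blast
  from bchoice[OF this] obtain C where
    C: "\<And>\<beta>. \<beta> \<in> {1..k} \<Longrightarrow> \<forall>\<^sub>F z in nhds 0. norm (f \<beta> z) \<le> C \<beta> * box_size (f \<beta>) z" by blast
  define C1 where "C1 = 1 + (\<Sum>\<beta>=1..k. \<bar>C \<beta>\<bar>)"
  have C1: "1 \<le> C1" by (simp add: C1_def sum_nonneg)
  have C_le: "C \<beta> \<le> C1" if "\<beta> \<in> {1..k}" for \<beta>
    using member_le_sum[OF that, of "\<lambda>\<beta>. \<bar>C \<beta>\<bar>"] by (simp add: C1_def)
  have ev: "\<forall>\<^sub>F z in nhds (0::complex^'n). norm z < 1"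
    by (auto simp: eventually_nhds_metric dist_norm intro!: exI[of _ 1])
  have evc: "\<forall>\<^sub>F z in nhds 0. \<forall>\<beta>\<in>{1..k}. z \<in> torus \<longrightarrow>
      c \<beta> * norm (g z) * box_size (f \<beta>) z \<le> norm (log_gradient g z) * norm (f \<beta> z)"
    by (rule eventually_ball_finite) (use c(2) in auto)
  have evC: "\<forall>\<^sub>F z in nhds 0. \<forall>\<beta>\<in>{1..k}. norm (f \<beta> z) \<le> C \<beta> * box_size (f \<beta>) z"
    by (rule eventually_ball_finite) (use C in auto)
  define N where "N = real CARD('n)"
  have N: "0 < N" by (simp add: N_def)
  have "\<forall>\<^sub>F z in nhds 0. z \<in> torus \<longrightarrow> c0 / (N * C1) * norm (g z) powr (1 - 1 / real b) \<le> norm (gradient g z)"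
    using ev evc evC
  proof (eventually_elim, intro impI)
    fix z :: "complex^'n"
    assume z1: "norm z < 1" and lower: "\<forall>\<beta>\<in>{1..k}. z \<in> torus \<longrightarrow>
      c \<beta> * norm (g z) * box_size (f \<beta>) z \<le> norm (log_gradient g z) * norm (f \<beta> z)"
      and upper: "\<forall>\<beta>\<in>{1..k}. norm (f \<beta> z) \<le> C \<beta> * box_size (f \<beta>) z" and tor: "z \<in> torus"
    show "c0 / (N * C1) * norm (g z) powr (1 - 1 / real b) \<le> norm (gradient g z)"
    proof (cases "g z = 0")
      case False
      define M where "M \<alpha> = box_size (f \<alpha>) z" for \<alpha>
      have M: "0 < M \<alpha>" if "\<alpha> \<in> {1..k}" for \<alpha>
        unfolding M_def by (rule box_size_pos[OF conv(1)[OF that] tor])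
      define \<epsilon> where "\<epsilon> = Min ((\<lambda>\<alpha>. norm (f \<alpha> z) / M \<alpha>) ` {1..k})"
      have "\<epsilon> \<in> (\<lambda>\<alpha>. norm (f \<alpha> z) / M \<alpha>) ` {1..k}" unfolding \<epsilon>_def using k by (intro Min_in) auto
      then obtain \<beta> where \<beta>: "\<beta> \<in> {1..k}" "\<epsilon> = norm (f \<beta> z) / M \<beta>" by auto
      have \<epsilon>_le: "\<epsilon> * M \<alpha> \<le> norm (f \<alpha> z)" if "\<alpha> \<in> {1..k}" for \<alpha>
      proof -
        have "\<epsilon> \<le> norm (f \<alpha> z) / M \<alpha>" unfolding \<epsilon>_def using that by (intro Min_le) auto
        then show ?thesis using M[OF that] by (simp add: pos_le_divide_eq)
      qed
      have \<epsilon>0: "0 \<le> \<epsilon>" using \<beta> M[OF \<beta>(1)] by simp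
      have "norm (f \<beta> z) \<le> C \<beta> * M \<beta>" using upper \<beta>(1) by (simp add: M_def)
      also have "\<dots> \<le> C1 * M \<beta>" using C_le[OF \<beta>(1)] M[OF \<beta>(1)] by (intro mult_right_mono) auto
      finally have "norm (f \<beta> z) \<le> C1 * M \<beta>" .
      then have \<epsilon>C: "\<epsilon> \<le> C1" using M[OF \<beta>(1)] by (simp add: \<beta>(2) divide_le_eq)
      have log: "c0 * norm (g z) \<le> \<epsilon> * norm (log_gradient g z)"
      proof -
        have "c0 * norm (g z) * M \<beta> \<le> c \<beta> * norm (g z) * M \<beta>"
          using c0_le[OF \<beta>(1)] M[OF \<beta>(1)] by (intro mult_right_mono) auto
        also have "\<dots> \<le> norm (log_gradient g z) * norm (f \<beta> z)" using lower \<beta>(1) tor by (simp add: M_def)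
        also have "\<dots> = \<epsilon> * norm (log_gradient g z) * M \<beta>" using M[OF \<beta>(1)] by (simp add: \<beta>(2))
        finally show ?thesis using M[OF \<beta>(1)] by simp
      qed
      define R where "R = norm (g z) powr (1 / real b)"
      have R: "R ^ b = norm (g z)"
      proof -
        have "R ^ b = R powr real b" using False by (subst powr_realpow) (auto simp: R_def)
        also have "\<dots> = norm (g z)" using b0 by (simp add: R_def powr_powr)
        finally show ?thesis .
      qed
      have z_le: "\<epsilon> * norm (z $ i) \<le> C1 * R" for i
      proof -
        let ?x = "norm (z $ i)" and ?B = "\<Sum>\<alpha>=1..k. m \<alpha> * axis_exponent (f \<alpha>) i"
        have x: "0 \<le> ?x" "?x \<le> 1"
          using Finite_Cartesian_Product.norm_nth_le[of z i] z1 by auto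
        have "\<epsilon> ^ S * ?x ^ ?B = (\<Prod>\<alpha>=1..k. (\<epsilon> * ?x ^ axis_exponent (f \<alpha>) i) ^ m \<alpha>)"
          by (simp add: S_def power_sum power_mult_distrib prod.distrib mult.commute flip: power_mult)
        also have "\<dots> \<le> (\<Prod>\<alpha>=1..k. norm (f \<alpha> z) ^ m \<alpha>)"
        proof (intro prod_mono conjI power_mono zero_le_power mult_nonneg_nonneg)
          fix \<alpha> assume \<alpha>: "\<alpha> \<in> {1..k}"
          have "\<epsilon> * ?x ^ axis_exponent (f \<alpha>) i \<le> \<epsilon> * M \<alpha>"
            unfolding M_def using axis_power_le_box_size[OF conv(1)[OF \<alpha>]] \<epsilon>0 by (intro mult_left_mono)
          then show "\<epsilon> * ?x ^ axis_exponent (f \<alpha>) i \<le> norm (f \<alpha> z)" using \<epsilon>_le[OF \<alpha>] by simp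
        qed (use \<epsilon>0 in auto)
        also have "\<dots> = norm (g z)" by (simp add: g norm_power flip: prod_norm)
        finally have gz: "\<epsilon> ^ S * ?x ^ ?B \<le> norm (g z)" .
        have "(\<epsilon> * ?x) ^ b = \<epsilon> ^ (b - S) * \<epsilon> ^ S * ?x ^ b"
          using Sb by (simp add: power_mult_distrib flip: power_add)
        also have "\<dots> \<le> C1 ^ b * \<epsilon> ^ S * ?x ^ ?B"
        proof (intro mult_mono)
          have "\<epsilon> ^ (b - S) \<le> C1 ^ (b - S)" using \<epsilon>C \<epsilon>0 by (rule power_mono)
          also have "\<dots> \<le> C1 ^ b" using C1 by (intro power_increasing) auto
          finally show "\<epsilon> ^ (b - S) \<le> C1 ^ b" .
          show "?x ^ b \<le> ?x ^ ?B" using b x by (intro power_decreasing) auto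
        qed (use \<epsilon>0 C1 in auto)
        also have "\<dots> \<le> C1 ^ b * norm (g z)"
          using mult_left_mono[OF gz, of "C1 ^ b"] C1 by (simp add: mult.assoc)
        also have "\<dots> = (C1 * R) ^ b" by (simp add: power_mult_distrib R)
        finally have le: "(\<epsilon> * ?x) ^ b \<le> (C1 * R) ^ b" .
        show ?thesis
        proof (rule ccontr)
          assume "\<not> ?thesis"
          then have "(C1 * R) ^ b < (\<epsilon> * ?x) ^ b"
            using C1 b0 by (intro power_strict_mono) (auto simp: R_def)
          then show False using le by simp
        qed
      qed
      have "norm (log_gradient g z) \<le> (\<Sum>i\<in>UNIV. norm (log_gradient g z $ i))"
        by (simp add: norm_vec_def L2_set_le_sum)
      then have "c0 * norm (g z) \<le> \<epsilon> * (\<Sum>i\<in>UNIV. norm (log_gradient g z $ i))"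
        using log mult_left_mono[OF _ \<epsilon>0] by (meson order_trans)
      also have "\<dots> = (\<Sum>i\<in>UNIV. \<epsilon> * norm (z $ i) * norm (gradient g z $ i))"
        by (simp add: log_gradient_def norm_mult sum_distrib_left mult.assoc)
      also have "\<dots> \<le> (\<Sum>i\<in>(UNIV::'n set). C1 * R * norm (gradient g z))"
        using C1 by (intro sum_mono mult_mono[OF z_le] Finite_Cartesian_Product.norm_nth_le) (auto simp: R_def)
      also have "\<dots> = N * C1 * R * norm (gradient g z)" by (simp add: N_def)
      finally have main: "c0 * norm (g z) \<le> N * C1 * R * norm (gradient g z)" .
      have Rpos: "0 < R" using False by (simp add: R_def)
      define G where "G = norm (g z) powr (1 - 1 / real b)"
      have "R * G = norm (g z)" using False by (simp add: R_def G_def flip: powr_add)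
      then have "R * (c0 * G) = c0 * norm (g z)" by (simp add: mult.left_commute)
      also note main
      also have "N * C1 * R * norm (gradient g z) = R * (N * C1 * norm (gradient g z))" by simp
      finally have "R * (c0 * G) \<le> R * (N * C1 * norm (gradient g z))" .
      then have "c0 * G \<le> N * C1 * norm (gradient g z)" using Rpos by simp
      moreover have "0 < N * C1" using N C1 by simp
      ultimately show ?thesis unfolding G_def[symmetric] by (simp add: pos_divide_le_eq mult.commute)
    qed simp
  qed
  moreover have "0 < c0 / (N * C1)" using c0 N C1 by simp
  ultimately show ?thesis by blast
qed

text \<open>
  A point off the torus is the limit of the points obtained by replacing its zero coordinates by
  \<open>1 / (n + 1)\<close>.
\<close>

lemma eventually_torus_imp_eventually:
  fixes P :: "complex ^ 'n \<Rightarrow> bool"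
  assumes ev: "\<forall>\<^sub>F z in nhds 0. z \<in> torus \<longrightarrow> P z"
    and closed: "\<forall>\<^sub>F z in nhds 0. \<forall>w. w \<longlonglongrightarrow> z \<longrightarrow> (\<forall>n::nat. P (w n)) \<longrightarrow> P z"
  shows "\<forall>\<^sub>F z in nhds 0. P z"
proof -
  have "\<forall>\<^sub>F z in nhds 0. \<forall>\<^sub>F y in nhds z. y \<in> torus \<longrightarrow> P y"
    using ev by (simp only: eventually_eventually)
  then show ?thesis using closed
  proof eventually_elim
    case (elim z)
    define t :: "complex ^ 'n" where "t = (\<chi> i. if z $ i = 0 then 1 else 0)"
    define w where "w n = z + of_real (1 / real (Suc n)) *s t" for n
    have "(\<lambda>n. 1 / real (Suc n)) \<longlonglongrightarrow> 0" using LIMSEQ_inverse_real_of_nat by (simp add: inverse_eq_divide)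
    then have "(\<lambda>n. z $ i + of_real (1 / real (Suc n)) * t $ i) \<longlonglongrightarrow> z $ i + of_real 0 * t $ i" for i
      by (intro tendsto_intros)
    then have wz: "w \<longlonglongrightarrow> z" unfolding w_def by (intro vec_tendstoI) simp
    have tor: "w n \<in> torus" for n
      by (auto simp: torus_def w_def t_def simp del: of_nat_Suc)
    have "\<forall>\<^sub>F n in sequentially. w n \<in> torus \<longrightarrow> P (w n)"
      using wz elim(1) by (rule filterlim_iff[THEN iffD1, rule_format])
    then obtain n0 where n0: "\<And>n. n0 \<le> n \<Longrightarrow> P (w n)"
      using tor unfolding eventually_sequentially by blast
    have "(\<lambda>n. w (n + n0)) \<longlonglongrightarrow> z" using wz by (rule LIMSEQ_ignore_initial_segment)
    then show ?case using elim(2) n0 by (metis le_add2)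
  qed
qed

text \<open>
  Both sides are continuous where \<open>g\<close> does not vanish. At a zero of \<open>g\<close> the left-hand side is \<open>0\<close>, also for
  \<open>\<theta> = 0\<close>, because \<open>0 powr 0 = 0\<close>.
\<close>

lemma gradient_bound_near_origin:
  fixes g :: "complex ^ 'n \<Rightarrow> complex"
  assumes an: "analytic_at_origin g" and ev: "\<forall>\<^sub>F z in nhds 0. z \<in> torus \<longrightarrow> c * norm (g z) powr \<theta> \<le> norm (gradient g z)"
  shows "\<forall>\<^sub>F z in nhds 0. c * norm (g z) powr \<theta> \<le> norm (gradient g z)"
proof (rule eventually_torus_imp_eventually[OF ev])
  note ps = has_power_series_coefficient[OF an]
  have "\<forall>\<^sub>F z in nhds 0. isCont g z \<and> (\<forall>i. isCont (\<lambda>z. gradient g z $ i) z)"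
    by (intro eventually_conj eventually_all_finite has_power_series_isCont[OF ps]
        has_power_series_isCont[OF has_power_series_gradient[OF ps]])
  then show "\<forall>\<^sub>F z in nhds 0. \<forall>w. w \<longlonglongrightarrow> z \<longrightarrow> (\<forall>n. c * norm (g (w n)) powr \<theta> \<le> norm (gradient g (w n)))
      \<longrightarrow> c * norm (g z) powr \<theta> \<le> norm (gradient g z)"
  proof (eventually_elim, intro allI impI)
    fix z and w :: "nat \<Rightarrow> complex ^ 'n"
    assume cont: "isCont g z \<and> (\<forall>i. isCont (\<lambda>z. gradient g z $ i) z)" and w: "w \<longlonglongrightarrow> z"
      and le: "\<forall>n. c * norm (g (w n)) powr \<theta> \<le> norm (gradient g (w n))"
    show "c * norm (g z) powr \<theta> \<le> norm (gradient g z)"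
    proof (cases "g z = 0")
      case False
      have "(\<lambda>n. g (w n)) \<longlonglongrightarrow> g z" using cont w by (intro isCont_tendsto_compose[of z g]) auto
      then have "(\<lambda>n. c * norm (g (w n)) powr \<theta>) \<longlonglongrightarrow> c * norm (g z) powr \<theta>"
        using False by (intro tendsto_mult tendsto_const tendsto_powr tendsto_norm) auto
      moreover have "(\<lambda>n. gradient g (w n) $ i) \<longlonglongrightarrow> gradient g z $ i" for i
        using isCont_tendsto_compose[of z "\<lambda>z. gradient g z $ i", OF _ w] cont by simp
      then have "(\<lambda>n. gradient g (w n)) \<longlonglongrightarrow> gradient g z" by (rule vec_tendstoI)
      then have "(\<lambda>n. norm (gradient g (w n))) \<longlonglongrightarrow> norm (gradient g z)" by (rule tendsto_norm)
      ultimately show ?thesis by (rule LIMSEQ_le) (use le in auto)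
    qed simp
  qed
qed

section \<open>Orders along the coordinate axes\<close>

text \<open>
  On the axis only the pure powers of \<open>z\<^sub>j\<close> survive, and those of degree above \<open>n\<close> are bounded by a
  convergent series times \<open>|w| ^ (n + 1)\<close>.
\<close>

lemma axis_leading_term:
  fixes h :: "complex ^ 'n \<Rightarrow> complex"
  assumes h: "has_power_series h c" and zero: "\<And>a. a < n \<Longrightarrow> c (axis j a) = 0"
  shows "((\<lambda>w. h (axis j w) / w ^ n) \<longlongrightarrow> c (axis j n)) (at 0)"
proof -
  obtain r where conv: "converges_on r h c" using h has_power_series_iff by blast
  then have r: "0 < r" and sm: "(\<lambda>\<nu>. norm (c \<nu>) * r ^ total_degree \<nu>) summable_on UNIV"
    by (simp_all add: converges_on_def)
  define S where "S = infsum (\<lambda>\<nu>. norm (c \<nu>) * r ^ total_degree \<nu>) (UNIV - {axis j n})"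
  have S: "((\<lambda>\<nu>. norm (c \<nu>) * r ^ total_degree \<nu>) has_sum S) (UNIV - {axis j n})"
    unfolding S_def by (intro has_sum_infsum summable_on_subset_banach[OF sm]) auto
  have bound: "norm (h (axis j w) - c (axis j n) * w ^ n) \<le> S * (norm w / r) ^ (n + 1)" if w: "norm w \<le> r" for w
  proof -
    have "axis j w \<in> polydisc r" using w r by (auto simp: polydisc_def axis_def)
    then have "((\<lambda>\<nu>. c \<nu> * monomial_at \<nu> (axis j w)) has_sum h (axis j w)) UNIV"
      using conv by (simp add: converges_on_def)
    then have diff: "((\<lambda>\<nu>. c \<nu> * monomial_at \<nu> (axis j w)) has_sum
        (h (axis j w) - (\<Sum>\<nu>\<in>{axis j n}. c \<nu> * monomial_at \<nu> (axis j w)))) (UNIV - {axis j n})"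
      by (rule has_sum_Diff) (rule has_sum_finite, simp_all)
    have "norm (h (axis j w) - (\<Sum>\<nu>\<in>{axis j n}. c \<nu> * monomial_at \<nu> (axis j w))) \<le> S * (norm w / r) ^ (n + 1)"
    proof (rule norm_infsum_le[OF diff has_sum_cmult_left[OF S]])
      fix \<nu> assume \<nu>: "\<nu> \<in> UNIV - {axis j n}"
      have nonneg: "0 \<le> norm (c \<nu>) * r ^ total_degree \<nu> * (norm w / r) ^ (n + 1)" using r by simp
      show "norm (c \<nu> * monomial_at \<nu> (axis j w)) \<le> norm (c \<nu>) * r ^ total_degree \<nu> * (norm w / r) ^ (n + 1)"
      proof (cases "\<exists>l. l \<noteq> j \<and> \<nu> $ l \<noteq> 0")
        case True
        then have "monomial_at \<nu> (axis j w) = 0" by (auto simp: monomial_at_def axis_def)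
        then show ?thesis using nonneg by simp
      next
        case False
        define a where "a = \<nu> $ j"
        have \<nu>a: "\<nu> = axis j a" using False by (auto simp: vec_eq_iff axis_def a_def)
        show ?thesis
        proof (cases "a < n")
          case True
          then show ?thesis using zero nonneg by (simp add: \<nu>a)
        next
          case False
          then have "n + 1 \<le> a" using \<nu> \<nu>a by (cases "a = n") auto
          then have "(norm w / r) ^ a \<le> (norm w / r) ^ (n + 1)"
            using r w by (intro power_decreasing) auto
          then have "r ^ a * (norm w / r) ^ a \<le> r ^ a * (norm w / r) ^ (n + 1)"
            by (rule mult_left_mono) (use r in simp)
          moreover have "r ^ a * (norm w / r) ^ a = norm w ^ a" using r by (simp add: power_divide)
          ultimately have "norm w ^ a \<le> r ^ a * (norm w / r) ^ (n + 1)" by (simp only:)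
          from mult_left_mono[OF this norm_ge_zero[of "c \<nu>"]]
          show ?thesis
            unfolding \<nu>a monomial_at_axis total_degree_axis by (simp only: norm_mult norm_power axis_nth mult.assoc)
        qed
      qed
    qed
    then show ?thesis by (simp add: monomial_at_axis)
  qed
  have "((\<lambda>w. h (axis j w) / w ^ n - c (axis j n)) \<longlongrightarrow> 0) (at 0)"
  proof (rule Lim_null_comparison)
    have "\<forall>\<^sub>F w in at (0::complex). w \<noteq> 0 \<and> norm w < r"
      using r by (auto simp: eventually_at dist_norm)
    then show "\<forall>\<^sub>F w in at 0. norm (h (axis j w) / w ^ n - c (axis j n)) \<le> S / r ^ (n + 1) * norm w"
    proof (rule eventually_mono)
      fix w :: complex assume w: "w \<noteq> 0 \<and> norm w < r"
      have "norm (h (axis j w) / w ^ n - c (axis j n)) = norm (h (axis j w) - c (axis j n) * w ^ n) / norm w ^ n"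
        using w by (simp add: diff_divide_distrib flip: norm_power norm_divide)
      also have "\<dots> \<le> S * (norm w / r) ^ (n + 1) / norm w ^ n"
        using bound[of w] w by (intro divide_right_mono) auto
      also have "\<dots> = S / r ^ (n + 1) * norm w" using w by (simp add: power_divide)
      finally show "norm (h (axis j w) / w ^ n - c (axis j n)) \<le> S / r ^ (n + 1) * norm w" .
    qed
    have "((\<lambda>w::complex. S / r ^ (n + 1) * norm w) \<longlongrightarrow> S / r ^ (n + 1) * norm (0::complex)) (at 0)"
      by (rule tendsto_mult[OF tendsto_const tendsto_norm[OF tendsto_ident_at]])
    then show "((\<lambda>w::complex. S / r ^ (n + 1) * norm w) \<longlongrightarrow> 0) (at 0)" by simp
  qed
  then show ?thesis by (simp add: LIM_zero_iff)
qed

text \<open>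
  The converse: the asymptotics on the axis determine the order. A lower coefficient is the limit of the
  quotient by a smaller power of \<open>w\<close>, which is zero.
\<close>

lemma axis_order_from_limit:
  fixes h :: "complex ^ 'n \<Rightarrow> complex"
  assumes h: "has_power_series h c" and lim: "((\<lambda>w. h (axis j w) / w ^ b) \<longlongrightarrow> C) (at 0)"
  shows "a < b \<Longrightarrow> c (axis j a) = 0" and "c (axis j b) = C"
proof -
  show zero: "c (axis j a) = 0" if "a < b" for a
    using that
  proof (induction a rule: less_induct)
    case (less a)
    then have "((\<lambda>w. h (axis j w) / w ^ a) \<longlongrightarrow> c (axis j a)) (at 0)"
      by (intro axis_leading_term[OF h]) auto
    moreover have "((\<lambda>w. h (axis j w) / w ^ b * w ^ (b - a)) \<longlongrightarrow> C * 0 ^ (b - a)) (at 0)"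
      by (intro tendsto_intros lim)
    then have "((\<lambda>w. h (axis j w) / w ^ a) \<longlongrightarrow> C * 0 ^ (b - a)) (at 0)"
    proof (rule Lim_transform_eventually)
      have "\<forall>\<^sub>F w in at (0::complex). w \<noteq> 0" by (auto simp: eventually_at intro: exI[of _ 1])
      then show "\<forall>\<^sub>F w in at 0. h (axis j w) / w ^ b * w ^ (b - a) = h (axis j w) / w ^ a"
        using less.prems by (auto elim!: eventually_mono simp: power_diff)
    qed
    ultimately have "c (axis j a) = C * 0 ^ (b - a)" by (rule tendsto_unique[rotated]) simp
    then show ?case using less.prems by simp
  qed
  then have "((\<lambda>w. h (axis j w) / w ^ b) \<longlongrightarrow> c (axis j b)) (at 0)"
    by (intro axis_leading_term[OF h])
  then show "c (axis j b) = C" using lim by (rule tendsto_unique[rotated]) simp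
qed

lemma axis_leading_coefficient:
  assumes an: "analytic_at_origin h" and h: "convenient h"
  shows "((\<lambda>w. h (axis j w) / w ^ axis_exponent h j) \<longlongrightarrow> coefficient h (axis j (axis_exponent h j))) (at 0)"
proof (rule axis_leading_term[OF has_power_series_coefficient[OF an]])
  fix a assume "a < axis_exponent h j"
  then have "axis j a \<notin> support h"
    using not_less_Least by (auto simp: axis_exponent_eq_Least[OF convenient_support[OF h]])
  then show "coefficient h (axis j a) = 0" by (simp add: support_def)
qed

text \<open>
  Orders on an axis add up under multiplication, since the leading coefficients are nonzero. This identifies
  the axis exponents of the product without computing its Newton polyhedron.
\<close>

lemma axis_exponent_prod_powers:
  fixes f :: "'b \<Rightarrow> complex ^ 'n \<Rightarrow> complex"
  assumes A: "finite A" and f: "\<And>a. a \<in> A \<Longrightarrow> analytic_at_origin (f a)" "\<And>a. a \<in> A \<Longrightarrow> convenient (f a)"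
    and g: "g = (\<lambda>z. \<Prod>a\<in>A. f a z ^ m a)"
    and b: "b = (\<Sum>a\<in>A. m a * axis_exponent (f a) j)"
  shows "axis_exponent g j = b" and "axis j b \<in> support g"
    and "a < b \<Longrightarrow> coefficient g (axis j a) = 0"
proof -
  have an: "analytic_at_origin g" unfolding g
    using A f(1) by (intro analytic_at_origin_prod analytic_at_origin_power)
  define C where "C = (\<Prod>a\<in>A. coefficient (f a) (axis j (axis_exponent (f a) j)) ^ m a)"
  have C: "C \<noteq> 0" using convenient_support[OF f(2)] A by (simp add: C_def support_def)
  have "((\<lambda>w. \<Prod>a\<in>A. (f a (axis j w) / w ^ axis_exponent (f a) j) ^ m a) \<longlongrightarrow> C) (at 0)"
    unfolding C_def using f by (intro tendsto_prod tendsto_power axis_leading_coefficient) auto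
  moreover have "(\<Prod>a\<in>A. (f a (axis j w) / w ^ axis_exponent (f a) j) ^ m a) = g (axis j w) / w ^ b" for w
    by (simp add: g b power_sum power_divide prod_dividef mult.commute flip: power_mult)
  ultimately have lim: "((\<lambda>w. g (axis j w) / w ^ b) \<longlongrightarrow> C) (at 0)" by simp
  show zero: "coefficient g (axis j a) = 0" if "a < b" for a
    by (rule axis_order_from_limit(1)[OF has_power_series_coefficient[OF an] lim that])
  show mem: "axis j b \<in> support g"
    using axis_order_from_limit(2)[OF has_power_series_coefficient[OF an] lim] C by (simp add: support_def)
  have "(LEAST a. axis j a \<in> support g) = b"
    by (rule Least_equality[where P = "\<lambda>a. axis j a \<in> support g", OF mem]) (use zero in \<open>force simp: support_def not_less[symmetric]\<close>)
  then show "axis_exponent g j = b" by (simp only: axis_exponent_eq_Least[OF mem])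
qed

text \<open>
  Dividing the inequality on the axis by \<open>|w| ^ (b * \<theta>)\<close> leaves a positive limit on the left. On the right
  the gradient has order at least \<open>b - 1\<close>: the hypotheses remove the lower terms of \<open>\<partial>\<^sub>j g\<close> and of the other
  partial derivatives. If \<open>b * \<theta> < b - 1\<close> the right-hand side would tend to zero.
\<close>

lemma exponent_lower_bound:
  fixes g :: "complex ^ 'n \<Rightarrow> complex"
  assumes an: "analytic_at_origin g" and b: "0 < b" and mem: "axis j b \<in> support g"
    and zero: "\<And>a. a < b \<Longrightarrow> coefficient g (axis j a) = 0"
    and nonexc: "\<And>i a. i \<noteq> j \<Longrightarrow> a + 1 < b \<Longrightarrow> coefficient g (axis j a + axis i 1) = 0"
    and c: "0 < c" and ineq: "\<forall>\<^sub>F z in nhds 0. c * norm (g z) powr \<theta> \<le> norm (gradient g z)"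
  shows "1 - 1 / real b \<le> \<theta>"
proof (rule ccontr)
  assume "\<not> ?thesis"
  then have \<theta>: "real b * \<theta> < real b - 1" using b by (simp add: field_simps)
  note ps = has_power_series_coefficient[OF an]
  define C where "C = coefficient g (axis j b)"
  have C: "C \<noteq> 0" using mem by (simp add: C_def support_def)
  have lim_g: "((\<lambda>w. g (axis j w) / w ^ b) \<longlongrightarrow> C) (at 0)"
    unfolding C_def by (rule axis_leading_term[OF ps zero])
  have "\<exists>K. ((\<lambda>w. gradient g (axis j w) $ i / w ^ (b - 1)) \<longlongrightarrow> K) (at 0)" for i
  proof (rule exI, rule axis_leading_term[OF has_power_series_gradient[OF ps]])
    fix a assume a: "a < b - 1"
    show "of_nat (axis j a $ i + 1) * coefficient g (axis j a + axis i 1) = 0"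
    proof (cases "i = j")
      case True
      have "axis j a + axis j 1 = axis j (a + 1)" by (auto simp: vec_eq_iff axis_def)
      then show ?thesis using a zero[of "a + 1"] True by simp
    next
      case False
      then show ?thesis using a nonexc[of i a] by simp
    qed
  qed
  then obtain K where K: "\<And>i. ((\<lambda>w. gradient g (axis j w) $ i / w ^ (b - 1)) \<longlongrightarrow> K i) (at 0)"
    by metis
  have "((\<lambda>w. \<Sum>i\<in>UNIV. norm (gradient g (axis j w) $ i / w ^ (b - 1))) \<longlongrightarrow> (\<Sum>i\<in>UNIV. norm (K i))) (at 0)"
    by (intro tendsto_sum tendsto_norm K)
  moreover have "((\<lambda>w::complex. norm w powr (real b - 1 - real b * \<theta>)) \<longlongrightarrow> 0) (at 0)"
    using \<theta> by (intro tendsto_zero_powrI[OF tendsto_norm_zero tendsto_const]) auto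
  ultimately have "((\<lambda>w. (\<Sum>i\<in>UNIV. norm (gradient g (axis j w) $ i / w ^ (b - 1))) * norm w powr (real b - 1 - real b * \<theta>))
      \<longlongrightarrow> (\<Sum>i\<in>UNIV. norm (K i)) * 0) (at 0)"
    by (rule tendsto_mult)
  then have upper: "((\<lambda>w. (\<Sum>i\<in>UNIV. norm (gradient g (axis j w) $ i / w ^ (b - 1))) * norm w powr (real b - 1 - real b * \<theta>))
      \<longlongrightarrow> 0) (at 0)" by (simp only: mult_zero_right)
  have lower: "((\<lambda>w. c * norm (g (axis j w) / w ^ b) powr \<theta>) \<longlongrightarrow> c * norm C powr \<theta>) (at 0)"
    using C by (intro tendsto_mult tendsto_const tendsto_powr tendsto_norm lim_g) auto
  have "c * norm C powr \<theta> \<le> 0"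
  proof (rule tendsto_le[OF _ upper lower])
    have "((\<lambda>w. axis j w :: complex ^ 'n) \<longlongrightarrow> 0) (at 0)"
    proof (rule vec_tendstoI)
      show "((\<lambda>w. (axis j w :: complex ^ 'n) $ i) \<longlongrightarrow> 0 $ i) (at 0)" for i
        by (cases "i = j") (simp_all add: axis_def)
    qed
    then have "\<forall>\<^sub>F w in at 0. c * norm (g (axis j w)) powr \<theta> \<le> norm (gradient g (axis j w))"
      using ineq by (rule filterlim_iff[THEN iffD1, rule_format])
    moreover have "\<forall>\<^sub>F w in at (0::complex). w \<noteq> 0" by (auto simp: eventually_at intro: exI[of _ 1])
    ultimately show "\<forall>\<^sub>F w in at 0. c * norm (g (axis j w) / w ^ b) powr \<theta> \<le>
      (\<Sum>i\<in>UNIV. norm (gradient g (axis j w) $ i / w ^ (b - 1))) * norm w powr (real b - 1 - real b * \<theta>)"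
    proof eventually_elim
      case (elim w)
      have w: "0 < norm w" using elim(2) by simp
      have pow_b: "norm w ^ n = norm w powr real n" for n using w by (simp add: powr_realpow)
      have "c * norm (g (axis j w) / w ^ b) powr \<theta> = c * norm (g (axis j w)) powr \<theta> / norm w powr (real b * \<theta>)"
        using w by (simp add: norm_divide norm_power pow_b powr_divide powr_powr)
      also have "\<dots> \<le> norm (gradient g (axis j w)) / norm w powr (real b * \<theta>)"
        using elim(1) by (intro divide_right_mono) auto
      also have "\<dots> \<le> (\<Sum>i\<in>UNIV. norm (gradient g (axis j w) $ i)) / norm w powr (real b * \<theta>)"
        by (intro divide_right_mono) (simp_all add: norm_vec_def L2_set_le_sum)
      also have "\<dots> = (\<Sum>i\<in>UNIV. norm (gradient g (axis j w) $ i)) / norm w ^ (b - 1) * norm w powr (real b - 1 - real b * \<theta>)"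
        using w b by (simp add: pow_b powr_diff of_nat_diff)
      finally show ?case by (simp add: norm_divide norm_power sum_divide_distrib)
    qed
  qed simp
  then show False using c C by (simp add: mult_le_0_iff)
qed

section \<open>The exponent\<close>

theorem theorem32:
  fixes f :: "nat \<Rightarrow> complex ^ 'n \<Rightarrow> complex"
    and g :: "complex ^ 'n \<Rightarrow> complex"
    and m :: "nat \<Rightarrow> nat"
    and k Bmax :: nat
    and B :: "'n \<Rightarrow> nat"
  assumes "k \<ge> 1"
    and "convenient_nondegenerate_family k f"
    and "\<And>\<alpha>. \<alpha> \<in> {1..k} \<Longrightarrow> f \<alpha> 0 = 0"
    and "\<And>\<alpha>. \<alpha> \<in> {1..k} \<Longrightarrow> m \<alpha> > 0"
    and "g = (\<lambda>z. \<Prod>\<alpha>=1..k. f \<alpha> z ^ m \<alpha>)"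
    and "B = (\<lambda>j. \<Sum>\<alpha>=1..k. m \<alpha> * axis_exponent (f \<alpha>) j)"
    and "Bmax = Max (range B)"
  shows "lojasiewicz_exponent g \<le> ereal (1 - 1 / real Bmax) \<and>
    ((\<exists>j. lojasiewicz_monomial g j \<and> \<not> exceptional g j) \<longrightarrow>
      lojasiewicz_exponent g = ereal (1 - 1 / real Bmax))"
proof -
  have conv: "convenient (f \<alpha>)" "analytic_at_origin (f \<alpha>)" if "\<alpha> \<in> {1..k}" for \<alpha>
    using assms(2) that by (auto simp: convenient_nondegenerate_family_def)
  note prod = axis_exponent_prod_powers[OF finite_atLeastAtMost conv(2) conv(1) assms(5) fun_cong[OF assms(6)]]
  have an: "analytic_at_origin g" unfolding assms(5)
    using conv(2) by (intro analytic_at_origin_prod analytic_at_origin_power) auto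
  have B_eq: "axis_exponent g j = B j" for j by (rule prod(1))
  have B_le: "B j \<le> Bmax" for j unfolding assms(7) by (rule Max_ge) auto
  have B_pos: "0 < B j" for j unfolding assms(6)
  proof (rule sum_pos)
    fix \<alpha> assume \<alpha>: "\<alpha> \<in> {1..k}"
    show "0 < m \<alpha> * axis_exponent (f \<alpha>) j"
      using axis_exponent_pos[OF conv[OF \<alpha>] assms(3)[OF \<alpha>], of j] assms(4)[OF \<alpha>] by simp
  qed (use assms(1) in auto)
  have Bmax_pos: "0 < Bmax" using B_pos B_le by (meson less_le_trans)
  define \<Theta> where "\<Theta> = {\<theta>. 0 \<le> \<theta> \<and> \<theta> < 1 \<and>
      (\<exists>c>0. \<forall>\<^sub>F z in nhds 0. norm (gradient g z) \<ge> c * norm (g z) powr \<theta>)}"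
  have exponent: "lojasiewicz_exponent g = Inf (ereal ` \<Theta>)"
    by (simp only: lojasiewicz_exponent_def \<Theta>_def)
  have "\<exists>c>0. \<forall>\<^sub>F z in nhds 0. z \<in> torus \<longrightarrow> c * norm (g z) powr (1 - 1 / real Bmax) \<le> norm (gradient g z)"
    by (rule gradient_bound_on_torus[OF assms(1-5)]) (use B_le in \<open>simp_all add: assms(6)\<close>)
  then have "1 - 1 / real Bmax \<in> \<Theta>"
    using gradient_bound_near_origin[OF an] Bmax_pos unfolding \<Theta>_def by fastforce
  then have upper: "lojasiewicz_exponent g \<le> ereal (1 - 1 / real Bmax)"
    unfolding exponent by (intro Inf_lower imageI)
  moreover have "ereal (1 - 1 / real Bmax) \<le> lojasiewicz_exponent g"
    if "lojasiewicz_monomial g j" "\<not> exceptional g j" for j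
  proof -
    have "axis_exponent g = B" using B_eq by blast
    then have max: "Max (range (axis_exponent g)) = Bmax" by (simp only: assms(7))
    have Bj: "B j = Bmax" using that(1) by (simp only: lojasiewicz_monomial_def max B_eq)
    have nonexc: "coefficient g (axis j a + axis i 1) = 0" if ia: "i \<noteq> j" "a + 1 < B j" for i a
    proof -
      have "axis j a + axis i 1 = (\<chi> l. if l = j then a else if l = i then 1 else 0)"
        using ia(1) by (auto simp: vec_eq_iff axis_def)
      then show ?thesis using that \<open>lojasiewicz_monomial g j\<close> \<open>\<not> exceptional g j\<close> ia Bj
        unfolding exceptional_def max by metis
    qed
    have "1 - 1 / real Bmax \<le> \<theta>" if \<theta>: "\<theta> \<in> \<Theta>" for \<theta>
    proof -
      obtain c where c: "0 < c" "\<forall>\<^sub>F z in nhds 0. c * norm (g z) powr \<theta> \<le> norm (gradient g z)"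
        using \<theta> by (auto simp: \<Theta>_def)
      show ?thesis unfolding Bj[symmetric]
        by (rule exponent_lower_bound[OF an B_pos _ _ nonexc c]) (use prod(2,3) in auto)
    qed
    then show ?thesis unfolding exponent by (intro Inf_greatest) auto
  qed
  ultimately show ?thesis by (metis antisym)
qed

end
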